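(* Let $\Phi$ be an irreducible affine reflection system whose underlying finite root system $\mathring{\Phi}$ is of simply-laced type (of rank at least $2$) or of type $C_n$ ($n\geq 3$), $F_4$ or $G_2$. A subset $\Psi\subseteq\Phi$ is a maximal closed subroot system with $\mathrm{Gr}(\Psi)=\mathring{\Phi}$ if and only if there exist a maximal subgroup $H\subseteq\Lambda_s$ and a $\mathbb{Z}$-linear function $\tau:\mathring{\Phi}\to\Lambda_s/H$ such that $\tau(\beta)\cap\Lambda_\ell\neq\emptyset$ for all $\beta\in\mathring{\Phi}_\ell$ and $$\Psi=\{\alpha\oplus\tau(\alpha):\alpha\in\mathring{\Phi}_s\}\cup\{\alpha\oplus(\tau(\alpha)\cap\Lambda_\ell):\alpha\in\mathring{\Phi}_\ell\}.$$
   Context: Finite root systems: $V$ is a finite-dimensional real Euclidean space with inner product $(\cdot,\cdot)$. A finite root system $\mathring{\Phi}\subset V$ is a finite spanning set with $0\notin\mathring{\Phi}$, $s_\alpha(\mathring{\Phi})=\mathring{\Phi}$ and $(\beta,\alpha^\vee)\in\mathbb{Z}$ for all $\alpha,\beta\in\mathring{\Phi}$, where $\alpha^\vee=2\alpha/(\alpha,\alpha)$ and $s_\alpha(v)=v-(v,\alpha^\vee)\alpha$. $\mathring{\Phi}_s$ and $\mathring{\Phi}_\ell$ are the sets of short and long roots; if only one root length occurs (simply-laced types $A_n,D_n,E_{6,7,8}$), every root is long (so $\mathring{\Phi}_s=\emptyset$). Extension datum (for reduced $\mathring{\Phi}$): a family $(\Lambda_\alpha)_{\alpha\in\mathring{\Phi}\cup\{0\}}$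 of subsets of a finite-dimensional real vector space $Y$ such that (1) $\Lambda_\beta-(\beta,\alpha^\vee)\Lambda_\alpha\subseteq\Lambda_{s_\alpha(\beta)}$ for all $\alpha,\beta\in\mathring{\Phi}$; (2) $0\in\Lambda_\alpha$ for all $\alpha\in\mathring{\Phi}\cup\{0\}$; (3) $Y$ is the real span of $\bigcup_\alpha\Lambda_\alpha$. For $\mathring{\Phi}$ irreducible, $\Lambda_\alpha$ ($\alpha\in\mathring{\Phi}$) depends only on the length of $\alpha$; the common values on short and long roots are denoted $\Lambda_s$ and $\Lambda_\ell$, with the convention $\Lambda_s=\Lambda_\ell$ in the simply-laced case. For the types considered in this statement, $\Lambda_s$ is a subgroup of $Y$. Affine reflection system: up to isomorphism, every affine reflection system is $\Phi=\bigcup_{\alpha\in\mathring{\Phi}\cup\{0\}}\alpha\oplus\Lambda_\alpha\subset X=V\oplus Y$ with form $(v_1\oplus y_1,v_2\oplus y_2)_X=(v_1,v_2)$, for a finite root system $\mathring{\Phi}$ and an extension datum; it is irreducible iff $\mathring{\Phi}$ is. Here $\alpha\oplus S=\{\alpha\oplus y:y\in S\}$ for a subset $S\subseteq Y$ (in particular for a coset $S$), and displayed sets of such expressions denote their unions. The real roots are $\Phi^{\mathrm{re}}=\bigcup_{\alpha\in\mathring{\Phi}}\alpha\oplus\Lambda_\alpha$, and $s_{\alpha\oplus y}(\beta\oplus z)=s_\alpha(\beta)\oplus(z-(\beta,\alpha^\vee)y)$. Subroot systems: a proper non-empty subset $\Psi\subsetneq\Phi^{\mathrm{re}}$ is a subroot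 system if $s_a(b)\in\Psi$ for all $a,b\in\Psi$; it is closed if $a,b\in\Psi$ and $a+b\in\Phi^{\mathrm{re}}$ imply $a+b\in\Psi$; it is a maximal closed subroot system if it is a closed subroot system and there is no closed subroot system $\Psi'$ with $\Psi\subsetneq\Psi'\subsetneq\Phi^{\mathrm{re}}$. The gradient is $\mathrm{Gr}(\Psi)=\{\alpha\in\mathring{\Phi}:\exists y\in\Lambda_\alpha,\ \alpha\oplus y\in\Psi\}$. $\mathbb{Z}$-linear: a function from a root system to an abelian group is $\mathbb{Z}$-linear if it is the restriction of a group homomorphism defined on the $\mathbb{Z}$-span of the root system. A maximal subgroup of a group is a proper subgroup not contained in any other proper subgroup. *)

theory Defs
  imports
    "HOL-Analysis.Analysis"
    "HOL-Algebra.Coset"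
    "HOL-Computational_Algebra.Group_Closure"
begin

text \<open>The Euclidean space \<open>V\<close> is the whole type \<open>'a\<close>.\<close>

definition cartan_int :: "'a::euclidean_space \<Rightarrow> 'a \<Rightarrow> real"  \<comment> \<open>\<open>(\<beta>, \<alpha>\<^sup>\<or>)\<close>\<close>
  where "cartan_int \<beta> \<alpha> = \<beta> \<bullet> ((2 / (\<alpha> \<bullet> \<alpha>)) *\<^sub>R \<alpha>)"

definition root_reflection :: "'a::euclidean_space \<Rightarrow> 'a \<Rightarrow> 'a"
  where "root_reflection \<alpha> v = v - cartan_int v \<alpha> *\<^sub>R \<alpha>"

definition finite_root_system :: "'a::euclidean_space set \<Rightarrow> bool"
  where "finite_root_system R \<longleftrightarrow>
    finite R \<and> span R = UNIV \<and> 0 \<notin> R \<and>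
    (\<forall>\<alpha>\<in>R. root_reflection \<alpha> ` R = R) \<and>
    (\<forall>\<alpha>\<in>R. \<forall>\<beta>\<in>R. cartan_int \<beta> \<alpha> \<in> \<int>)"

definition reduced_rs :: "'a::euclidean_space set \<Rightarrow> bool"
  where "reduced_rs R \<longleftrightarrow> (\<forall>\<alpha>\<in>R. \<forall>c. c *\<^sub>R \<alpha> \<in> R \<longrightarrow> c = 1 \<or> c = - 1)"

definition irreducible_rs :: "'a::euclidean_space set \<Rightarrow> bool"
  where "irreducible_rs R \<longleftrightarrow>
    R \<noteq> {} \<and>
    \<not> (\<exists>A B. A \<noteq> {} \<and> B \<noteq> {} \<and> A \<union> B = R \<and> A \<inter> B = {} \<and> (\<forall>a\<in>A. \<forall>b\<in>B. a \<bullet> b = 0))"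

text \<open>An irreducible reduced root system has at most two root lengths, so the roots that are not of
  maximal length are the short ones. If there is only one length, every root is long.\<close>

definition long_roots :: "'a::euclidean_space set \<Rightarrow> 'a set"
  where "long_roots R = {\<alpha>\<in>R. \<forall>\<beta>\<in>R. norm \<beta> \<le> norm \<alpha>}"

definition short_roots :: "'a::euclidean_space set \<Rightarrow> 'a set"
  where "short_roots R = R - long_roots R"

definition simply_laced :: "'a::euclidean_space set \<Rightarrow> bool"
  where "simply_laced R \<longleftrightarrow> (\<forall>\<alpha>\<in>R. \<forall>\<beta>\<in>R. norm \<alpha> = norm \<beta>)"

definition base_of :: "'a::euclidean_space set \<Rightarrow> 'a set \<Rightarrow> bool"
  where "base_of R B \<longleftrightarrow>
    B \<subseteq> R \<and> independent B \<and>
    (\<forall>\<alpha>\<in>R. \<exists>c :: 'a \<Rightarrow> nat.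
       \<alpha> = (\<Sum>\<beta>\<in>B. real (c \<beta>) *\<^sub>R \<beta>) \<or> \<alpha> = - (\<Sum>\<beta>\<in>B. real (c \<beta>) *\<^sub>R \<beta>))"

definition has_cartan_matrix :: "'a::euclidean_space set \<Rightarrow> nat \<Rightarrow> (nat \<Rightarrow> nat \<Rightarrow> int) \<Rightarrow> bool"
  where "has_cartan_matrix R n A \<longleftrightarrow>
    (\<exists>b. inj_on b {..<n} \<and> base_of R (b ` {..<n}) \<and>
         (\<forall>i<n. \<forall>j<n. cartan_int (b i) (b j) = of_int (A i j)))"

text \<open>Entry \<open>(i, j)\<close> is \<open>(\<alpha>\<^sub>i, \<alpha>\<^sub>j\<^sup>\<or>)\<close>, so an entry below \<open>-1\<close> means that \<open>\<alpha>\<^sub>i\<close> is longer than \<open>\<alpha>\<^sub>j\<close>.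
  With the numbering of Bourbaki shifted to start at 0: in type \<open>C\<^sub>n\<close> the last simple root is the
  only long one (the transposed matrix is that of \<open>B\<^sub>n\<close>), in type \<open>F\<^sub>4\<close> the first two are long, and
  in type \<open>G\<^sub>2\<close> the second one is long.\<close>

definition cartan_C :: "nat \<Rightarrow> nat \<Rightarrow> nat \<Rightarrow> int"
  where "cartan_C n i j =
    (if i = j then 2
     else if Suc i = n \<and> Suc j = i then - 2
     else if i = Suc j \<or> j = Suc i then - 1
     else 0)"

definition cartan_F4 :: "nat \<Rightarrow> nat \<Rightarrow> int"
  where "cartan_F4 i j =
    (if i = j then 2
     else if i = 1 \<and> j = 2 then - 2
     else if i = Suc j \<or> j = Suc i then - 1
     else 0)"

definition cartan_G2 :: "nat \<Rightarrow> nat \<Rightarrow> int"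
  where "cartan_G2 i j =
    (if i = j then 2 else if i = 1 \<and> j = 0 then - 3 else - 1)"

definition type_C :: "nat \<Rightarrow> 'a::euclidean_space set \<Rightarrow> bool"
  where "type_C n R \<longleftrightarrow> has_cartan_matrix R n (cartan_C n)"

definition type_F4 :: "'a::euclidean_space set \<Rightarrow> bool"
  where "type_F4 R \<longleftrightarrow> has_cartan_matrix R 4 cartan_F4"

definition type_G2 :: "'a::euclidean_space set \<Rightarrow> bool"
  where "type_G2 R \<longleftrightarrow> has_cartan_matrix R 2 cartan_G2"

text \<open>The space \<open>Y\<close> is a finite-dimensional subspace of the type \<open>'y\<close>, so that \<open>Y = {0}\<close> is allowed.
  Values of \<open>L\<close> outside \<open>R \<union> {0}\<close> are irrelevant. The element \<open>\<alpha> \<oplus> y\<close> of \<open>V \<oplus> Y\<close> is the pair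
  \<open>(\<alpha>, y)\<close>.\<close>

definition extension_datum ::
    "'a::euclidean_space set \<Rightarrow> 'y::real_vector set \<Rightarrow> ('a \<Rightarrow> 'y set) \<Rightarrow> bool"
  where "extension_datum R Y L \<longleftrightarrow>
    (\<exists>B. finite B \<and> Y = span B) \<and>
    (\<forall>\<alpha>\<in>insert 0 R. L \<alpha> \<subseteq> Y) \<and>
    (\<forall>\<alpha>\<in>R. \<forall>\<beta>\<in>R. \<forall>y\<in>L \<alpha>. \<forall>z\<in>L \<beta>.
       z - cartan_int \<beta> \<alpha> *\<^sub>R y \<in> L (root_reflection \<alpha> \<beta>)) \<and>
    (\<forall>\<alpha>\<in>insert 0 R. 0 \<in> L \<alpha>) \<and>
    span (\<Union>\<alpha>\<in>insert 0 R. L \<alpha>) = Y"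

definition common_value :: "'a set \<Rightarrow> ('a \<Rightarrow> 'b) \<Rightarrow> 'b"
  where "common_value A f = (THE v. \<forall>\<alpha>\<in>A. f \<alpha> = v)"

definition Lambda_long :: "'a::euclidean_space set \<Rightarrow> ('a \<Rightarrow> 'y set) \<Rightarrow> 'y set"
  where "Lambda_long R L = common_value (long_roots R) L"

definition Lambda_short :: "'a::euclidean_space set \<Rightarrow> ('a \<Rightarrow> 'y set) \<Rightarrow> 'y set"
  where "Lambda_short R L =
    (if short_roots R = {} then Lambda_long R L else common_value (short_roots R) L)"

definition affine_roots :: "'a::euclidean_space set \<Rightarrow> ('a \<Rightarrow> 'y set) \<Rightarrow> ('a \<times> 'y) set"
  where "affine_roots R L = (SIGMA \<alpha>:insert 0 R. L \<alpha>)"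

definition real_roots :: "'a::euclidean_space set \<Rightarrow> ('a \<Rightarrow> 'y set) \<Rightarrow> ('a \<times> 'y) set"
  where "real_roots R L = (SIGMA \<alpha>:R. L \<alpha>)"

fun affine_reflection ::
    "'a::euclidean_space \<times> 'y::real_vector \<Rightarrow> 'a \<times> 'y \<Rightarrow> 'a \<times> 'y"
  where "affine_reflection (\<alpha>, y) (\<beta>, z) = (root_reflection \<alpha> \<beta>, z - cartan_int \<beta> \<alpha> *\<^sub>R y)"

definition subroot_system ::
    "'a::euclidean_space set \<Rightarrow> ('a \<Rightarrow> 'y::real_vector set) \<Rightarrow> ('a \<times> 'y) set \<Rightarrow> bool"
  where "subroot_system R L \<Psi> \<longleftrightarrow>
    \<Psi> \<noteq> {} \<and> \<Psi> \<subset> real_roots R L \<and> (\<forall>a\<in>\<Psi>. \<forall>b\<in>\<Psi>. affine_reflection a b \<in> \<Psi>)"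

definition closed_subroot_system ::
    "'a::euclidean_space set \<Rightarrow> ('a \<Rightarrow> 'y::real_vector set) \<Rightarrow> ('a \<times> 'y) set \<Rightarrow> bool"
  where "closed_subroot_system R L \<Psi> \<longleftrightarrow>
    subroot_system R L \<Psi> \<and>
    (\<forall>a\<in>\<Psi>. \<forall>b\<in>\<Psi>. a + b \<in> real_roots R L \<longrightarrow> a + b \<in> \<Psi>)"

definition maximal_closed_subroot_system ::
    "'a::euclidean_space set \<Rightarrow> ('a \<Rightarrow> 'y::real_vector set) \<Rightarrow> ('a \<times> 'y) set \<Rightarrow> bool"
  where "maximal_closed_subroot_system R L \<Psi> \<longleftrightarrow>
    closed_subroot_system R L \<Psi> \<and>
    \<not> (\<exists>\<Psi>'. closed_subroot_system R L \<Psi>' \<and> \<Psi> \<subset> \<Psi>' \<and> \<Psi>' \<subset> real_roots R L)"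

definition gradient ::
    "'a::euclidean_space set \<Rightarrow> ('a \<Rightarrow> 'y set) \<Rightarrow> ('a \<times> 'y) set \<Rightarrow> 'a set"
  where "gradient R L \<Psi> = {\<alpha>\<in>R. \<exists>y\<in>L \<alpha>. (\<alpha>, y) \<in> \<Psi>}"

definition add_group :: "'a::ab_group_add set \<Rightarrow> 'a monoid"
  where "add_group S = \<lparr>carrier = S, mult = (+), one = 0\<rparr>"

definition maximal_subgroup :: "'a set \<Rightarrow> ('a, 'b) monoid_scheme \<Rightarrow> bool"
  where "maximal_subgroup H G \<longleftrightarrow>
    subgroup H G \<and> H \<noteq> carrier G \<and>
    \<not> (\<exists>K. subgroup K G \<and> K \<noteq> carrier G \<and> H \<subset> K)"

definition Z_linear ::
    "'a::euclidean_space set \<Rightarrow> ('g, 'b) monoid_scheme \<Rightarrow> ('a \<Rightarrow> 'g) \<Rightarrow> bool"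
  where "Z_linear R G \<tau> \<longleftrightarrow>
    (\<exists>h\<in>hom (add_group (group_closure R)) G. \<forall>\<alpha>\<in>R. \<tau> \<alpha> = h \<alpha>)"

end

theory Submission
  imports Defs
begin

text \<open>In each of the listed types the roots of minimal length contain a subsystem of type \<open>A\<^sub>2\<close>,
  which makes the set \<open>\<Lambda>\<^sub>s\<close> a group; nothing else about the type is used. Given a closed
  subroot system with full gradient, choose a linear map \<open>p\<close> on \<open>V\<close> whose value at each root of a
  base lies in the fibre over that root; closure under reflections extends this to every root. The fibres
  translated by \<open>- p\<close> satisfy the axioms of an extension datum, so for the same reason the translated
  fibre over a root of minimal length is a group \<open>H\<close>, and the fibre over every \<open>\<alpha>\<close> is
  \<open>(p \<alpha> + H) \<inter> \<Lambda>\<^sub>\<alpha>\<close>. Enlarging the system amounts to enlarging \<open>H\<close>, and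
  \<open>\<tau> \<alpha> = p \<alpha> + H\<close>.\<close>

section \<open>Root systems\<close>

text \<open>For two roots of equal minimal length with Cartan integer 1 it yields z - y, and fibres
  over roots of equal length agree, so the common fibre is closed under subtraction. Over a longer
  root, reflections give only that the translated fibre lies in H; closedness under sums supplies
  the converse. The function \<tau> takes values in a quotient, which has no canonical lift. Since
  simple roots are linearly independent, representatives can be chosen freely on them and extended
  linearly. The base enters through this independence and through the fact that every
  reflection-closed set containing it contains R, a form that fits fibres, which obey reflection
  rules, as well as homomorphisms. In the theorem the representatives \<open>p \<alpha>\<close> lie
  only in \<open>L \<sigma>\<close>; over long roots the condition that \<tau> meets the long fibres
  keeps the gradient full.\<close>

lemma cartan_int_eq: "cartan_int \<beta> \<alpha> = 2 * (\<beta> \<bullet> \<alpha>) / (\<alpha> \<bullet> \<alpha>)"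
  by (simp add: cartan_int_def)

lemma cartan_int_self: "\<alpha> \<noteq> 0 \<Longrightarrow> cartan_int \<alpha> \<alpha> = 2"
  by (simp add: cartan_int_eq)

lemma cartan_int_minus_left [simp]: "cartan_int (- \<beta>) \<alpha> = - cartan_int \<beta> \<alpha>"
  by (simp add: cartan_int_eq)

lemma root_reflection_self: "\<alpha> \<noteq> 0 \<Longrightarrow> root_reflection \<alpha> \<alpha> = - \<alpha>"
  by (simp add: root_reflection_def cartan_int_self scaleR_2)

lemma inner_root_reflection: "root_reflection \<alpha> v \<bullet> root_reflection \<alpha> w = v \<bullet> w"
  by (cases "\<alpha> = 0")
     (simp_all add: root_reflection_def cartan_int_eq inner_diff_left inner_diff_right
        inner_commute field_simps)

lemma norm_root_reflection [simp]: "norm (root_reflection \<alpha> v) = norm v"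
  by (simp add: norm_eq_sqrt_inner inner_root_reflection)

lemma root_reflection_involution [simp]: "root_reflection \<alpha> (root_reflection \<alpha> v) = v"
  by (cases "\<alpha> = 0")
     (simp_all add: root_reflection_def cartan_int_eq inner_diff_left field_simps
       flip: scaleR_add_left)

locale irreducible_root_system =
  fixes R :: "'a::euclidean_space set"
  assumes finite_rs: "finite_root_system R"
    and reduced: "reduced_rs R"
    and irreducible: "irreducible_rs R"
begin

lemma finite_R: "finite R" and zero_notin_R: "0 \<notin> R"
  and R_nonempty: "R \<noteq> {}"
  using finite_rs irreducible by (auto simp: finite_root_system_def irreducible_rs_def)

lemma root_nonzero: "\<alpha> \<in> R \<Longrightarrow> \<alpha> \<noteq> 0"
  using zero_notin_R by auto

lemma reflection_root: "\<alpha> \<in> R \<Longrightarrow> \<beta> \<in> R \<Longrightarrow> root_reflection \<alpha> \<beta> \<in> R"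
  using finite_rs by (auto simp: finite_root_system_def)

lemma cartan_int_Ints: "\<alpha> \<in> R \<Longrightarrow> \<beta> \<in> R \<Longrightarrow> cartan_int \<beta> \<alpha> \<in> \<int>"
  using finite_rs by (auto simp: finite_root_system_def)

lemma minus_root: "\<alpha> \<in> R \<Longrightarrow> - \<alpha> \<in> R"
  using reflection_root[of \<alpha> \<alpha>] root_reflection_self[of \<alpha>] root_nonzero by auto

lemma inner_pos: "\<alpha> \<in> R \<Longrightarrow> \<alpha> \<bullet> \<alpha> > 0"
  using root_nonzero by auto

lemma proportional_roots:
  assumes "\<alpha> \<in> R" "k *\<^sub>R \<alpha> \<in> R"
  shows "k *\<^sub>R \<alpha> = \<alpha> \<or> k *\<^sub>R \<alpha> = - \<alpha>"
proof -
  have "k = 1 \<or> k = -1"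
    using assms reduced unfolding reduced_rs_def by blast
  then show ?thesis by auto
qed

text \<open>Equality would make \<beta> a multiple of \<alpha>, and in a reduced system the only
  such roots are \<alpha> and its negative.\<close>

lemma cauchy_schwarz_roots:
  assumes "\<alpha> \<in> R" "\<beta> \<in> R" "\<beta> \<noteq> \<alpha>" "\<beta> \<noteq> - \<alpha>"
  shows "(\<alpha> \<bullet> \<beta>)\<^sup>2 < (\<alpha> \<bullet> \<alpha>) * (\<beta> \<bullet> \<beta>)"
proof -
  have n: "norm \<alpha> > 0" using assms root_nonzero by auto
  have "\<bar>\<alpha> \<bullet> \<beta>\<bar> \<noteq> norm \<alpha> * norm \<beta>"
  proof
    assume "\<bar>\<alpha> \<bullet> \<beta>\<bar> = norm \<alpha> * norm \<beta>"
    then have "norm \<alpha> *\<^sub>R \<beta> = norm \<beta> *\<^sub>R \<alpha> \<or> norm \<alpha> *\<^sub>R \<beta> = - norm \<beta> *\<^sub>R \<alpha>"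
      by (simp add: norm_cauchy_schwarz_abs_eq)
    then obtain k where "norm \<alpha> *\<^sub>R \<beta> = k *\<^sub>R \<alpha>" by blast
    then have "(1 / norm \<alpha>) *\<^sub>R (norm \<alpha> *\<^sub>R \<beta>) = (1 / norm \<alpha>) *\<^sub>R (k *\<^sub>R \<alpha>)" by simp
    then have "\<beta> = (k / norm \<alpha>) *\<^sub>R \<alpha>" using n by simp
    then show False using proportional_roots[of \<alpha> "k / norm \<alpha>"] assms by simp
  qed
  then have "\<bar>\<alpha> \<bullet> \<beta>\<bar> < norm \<alpha> * norm \<beta>"
    using Cauchy_Schwarz_ineq2[of \<alpha> \<beta>] by simp
  then have "\<bar>\<alpha> \<bullet> \<beta>\<bar>\<^sup>2 < (norm \<alpha> * norm \<beta>)\<^sup>2"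
    by (intro power_strict_mono) auto
  then show ?thesis by (simp add: power_mult_distrib power2_norm_eq_inner)
qed

text \<open>The product \<open>m * l\<close> of the two Cartan integers is four times the squared
  cosine of the angle, hence 1, 2 or 3. As \<beta> is at least as long as \<alpha>, the absolute
  value of m is at most that of l, and 2 for both would already give 4. So m is 1 or -1, and
  \<open>m * l\<close> is the ratio of squared lengths.\<close>

lemma cartan_int_cases:
  assumes "\<alpha> \<in> R" "\<beta> \<in> R" "\<beta> \<noteq> \<alpha>" "\<beta> \<noteq> - \<alpha>" "\<alpha> \<bullet> \<beta> \<noteq> 0" "norm \<alpha> \<le> norm \<beta>"
  shows "cartan_int \<alpha> \<beta> \<in> {1, - 1}" "(\<beta> \<bullet> \<beta>) / (\<alpha> \<bullet> \<alpha>) \<in> {1, 2, 3}"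
proof -
  have pos: "\<alpha> \<bullet> \<alpha> > 0" "\<beta> \<bullet> \<beta> > 0" using assms inner_pos by auto
  have le: "\<alpha> \<bullet> \<alpha> \<le> \<beta> \<bullet> \<beta>" using assms(6) by (simp add: norm_eq_sqrt_inner)
  obtain m where m: "cartan_int \<alpha> \<beta> = of_int m"
    using cartan_int_Ints[of \<beta> \<alpha>] assms by (auto elim: Ints_cases)
  obtain l where l: "cartan_int \<beta> \<alpha> = of_int l"
    using cartan_int_Ints[of \<alpha> \<beta>] assms by (auto elim: Ints_cases)
  have m': "2 * (\<alpha> \<bullet> \<beta>) = m * (\<beta> \<bullet> \<beta>)"
    using m pos by (simp add: cartan_int_eq field_simps)
  have l': "2 * (\<alpha> \<bullet> \<beta>) = l * (\<alpha> \<bullet> \<alpha>)"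
    using l pos by (simp add: cartan_int_eq field_simps inner_commute)
  have "m \<noteq> 0" using m' assms(5) by auto
  have "(m * l) * ((\<alpha> \<bullet> \<alpha>) * (\<beta> \<bullet> \<beta>)) = (2 * (\<alpha> \<bullet> \<beta>)) * (2 * (\<alpha> \<bullet> \<beta>))"
    unfolding m' by (metis (no_types, opaque_lifting) l' m' mult.assoc mult.commute mult.left_commute of_int_mult)
  also have "\<dots> < 4 * ((\<alpha> \<bullet> \<alpha>) * (\<beta> \<bullet> \<beta>))"
    using cauchy_schwarz_roots[OF assms(1-4)] by (simp add: power2_eq_square)
  finally have "real_of_int (m * l) < 4"
    using pos by simp
  then have ml: "m * l < 4" by linarith
  have eq: "m * (\<beta> \<bullet> \<beta>) = l * (\<alpha> \<bullet> \<alpha>)" using m' l' by simp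
  then have "m * m * (\<beta> \<bullet> \<beta>) = (m * l) * (\<alpha> \<bullet> \<alpha>)" by simp
  have "\<bar>real_of_int l\<bar> * (\<alpha> \<bullet> \<alpha>) = \<bar>real_of_int m\<bar> * (\<beta> \<bullet> \<beta>)"
    using eq pos by (metis abs_mult abs_of_pos)
  also have "\<dots> \<ge> \<bar>real_of_int m\<bar> * (\<alpha> \<bullet> \<alpha>)" using le by (simp add: mult_left_mono)
  finally have "\<bar>m\<bar> \<le> \<bar>l\<bar>" using pos by simp
  have "m * m * (\<beta> \<bullet> \<beta>) > 0" using \<open>m \<noteq> 0\<close> pos by (simp add: zero_less_mult_iff) linarith
  then have "(m * l) * (\<alpha> \<bullet> \<alpha>) > 0"
    using \<open>m * m * (\<beta> \<bullet> \<beta>) = (m * l) * (\<alpha> \<bullet> \<alpha>)\<close> by linarith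
  then have "0 < m * l"
    using pos by (metis mult.commute of_int_0_less_iff of_int_mult zero_less_mult_pos)
  have "\<bar>m\<bar> < 2"
  proof (rule ccontr)
    assume "\<not> \<bar>m\<bar> < 2"
    then have "2 * 2 \<le> \<bar>m\<bar> * \<bar>l\<bar>" using \<open>\<bar>m\<bar> \<le> \<bar>l\<bar>\<close> by (intro mult_mono) auto
    then show False using ml \<open>0 < m * l\<close> by (simp flip: abs_mult)
  qed
  then have m1: "m = 1 \<or> m = -1" using \<open>m \<noteq> 0\<close> by linarith
  then show "cartan_int \<alpha> \<beta> \<in> {1, - 1}" using m by auto
  have "(\<beta> \<bullet> \<beta>) / (\<alpha> \<bullet> \<alpha>) = m * l"
    using \<open>m * m * (\<beta> \<bullet> \<beta>) = (m * l) * (\<alpha> \<bullet> \<alpha>)\<close> m1 pos by (auto simp: field_simps)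
  moreover have "m * l \<in> {1,2,3}" using \<open>0 < m * l\<close> ml by auto
  ultimately show "(\<beta> \<bullet> \<beta>) / (\<alpha> \<bullet> \<alpha>) \<in> {1, 2, 3}" by (auto simp del: of_int_mult)
qed

text \<open>For a positive inner product, the Cartan integer of the shorter root against the longer
  one is 1, so reflecting the shorter root subtracts the longer one. Negation covers the other
  order.\<close>

lemma diff_root:
  assumes "\<alpha> \<in> R" "\<beta> \<in> R" "\<beta> \<noteq> \<alpha>" "\<alpha> \<bullet> \<beta> > 0"
  shows "\<alpha> - \<beta> \<in> R"
proof -
  have *: "a - b \<in> R \<and> b - a \<in> R" if "a \<in> R" "b \<in> R" "b \<noteq> a" "a \<bullet> b > 0" "norm a \<le> norm b" for a b
  proof -
    have "b \<noteq> - a" using that inner_pos[of a] by (auto simp del: inner_gt_zero_iff)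
    then have "cartan_int a b \<in> {1, -1}" using cartan_int_cases that by simp
    moreover have "cartan_int a b > 0" using that inner_pos[of b] by (simp add: cartan_int_eq)
    ultimately have "a - b = root_reflection b a" by (auto simp: root_reflection_def)
    then show ?thesis using reflection_root minus_root that by (metis minus_diff_eq)
  qed
  show ?thesis
    using *[of \<alpha> \<beta>] *[of \<beta> \<alpha>] assms by (metis inner_commute nle_le)
qed

end

section \<open>Simple roots\<close>

lemma generic_functional:
  fixes S :: "'a::euclidean_space set"
  assumes "finite S" "0 \<notin> S"
  shows "\<exists>v. \<forall>a\<in>S. a \<bullet> v \<noteq> 0"
proof -
  \<comment> \<open>Finitely many hyperplanes form a null set and cannot cover the space.\<close>
  have "negligible (\<Union>a\<in>S. {x. a \<bullet> x = 0})"
    using assms by (intro negligible_Union) (auto intro!: negligible_hyperplane)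
  then have "(\<Union>a\<in>S. {x. a \<bullet> x = 0}) \<noteq> UNIV" using non_negligible_UNIV by metis
  then show ?thesis by blast
qed

text \<open>In a linear relation, move the terms with nonpositive coefficients to the other side.
  The common value x of both sides satisfies \<open>x \<bullet> x \<le> 0\<close> by obtuseness, so
  it vanishes; pairing each side with v then kills every coefficient.\<close>

lemma independent_obtuse:
  fixes D :: "'a::euclidean_space set"
  assumes "finite D" and pos: "\<And>d. d \<in> D \<Longrightarrow> d \<bullet> v > 0"
    and obt: "\<And>d e. d \<in> D \<Longrightarrow> e \<in> D \<Longrightarrow> d \<noteq> e \<Longrightarrow> d \<bullet> e \<le> 0"
  shows "independent D"
proof -
  have "u w = 0" if u: "(\<Sum>d\<in>D. u d *\<^sub>R d) = 0" and w: "w \<in> D" for u w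
  proof -
    define A where "A = {d\<in>D. u d > 0}"
    define B where "B = {d\<in>D. \<not> u d > 0}"
    define x where "x = (\<Sum>d\<in>A. u d *\<^sub>R d)"
    have AB: "A \<union> B = D" "A \<inter> B = {}" "finite A" "finite B" using \<open>finite D\<close> by (auto simp: A_def B_def)
    have "x + (\<Sum>d\<in>B. u d *\<^sub>R d) = 0"
      using u AB unfolding x_def by (metis sum.union_disjoint)
    then have xB: "x = (\<Sum>d\<in>B. (- u d) *\<^sub>R d)" by (simp add: sum_negf add_eq_0_iff)
    have "x \<bullet> x = (\<Sum>d\<in>A. u d *\<^sub>R d) \<bullet> (\<Sum>e\<in>B. (- u e) *\<^sub>R e)"
      using xB x_def by simp
    also have "\<dots> = (\<Sum>e\<in>B. \<Sum>d\<in>A. u d * (- u e) * (d \<bullet> e))"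
      by (simp add: inner_sum_left inner_sum_right sum_distrib_left sum_negf mult_ac)
    also have "\<dots> \<le> 0"
    proof (intro sum_nonpos)
      fix d e assume "d \<in> A" "e \<in> B"
      then have "u d * (- u e) \<ge> 0" "d \<bullet> e \<le> 0"
        using obt by (auto simp: A_def B_def mult_le_0_iff intro!: obt)
      then show "u d * (- u e) * (d \<bullet> e) \<le> 0" by (rule mult_nonneg_nonpos)
    qed
    finally have x0: "x = 0" by (metis inner_eq_zero_iff inner_ge_zero order_antisym)
    have "(\<Sum>d\<in>A. u d * (d \<bullet> v)) = x \<bullet> v" by (simp add: x_def inner_sum_left)
    then have "(\<Sum>d\<in>A. u d * (d \<bullet> v)) = 0" using x0 by simp
    then have "\<forall>d\<in>A. u d * (d \<bullet> v) = 0"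
      using AB pos by (subst (asm) sum_nonneg_eq_0_iff) (auto simp: A_def intro!: mult_nonneg_nonneg less_imp_le)
    then have "A = {}" using pos by (auto simp: A_def) fastforce
    have "(\<Sum>d\<in>B. (- u d) * (d \<bullet> v)) = x \<bullet> v" by (simp only: xB inner_sum_left inner_scaleR_left)
    then have "(\<Sum>d\<in>B. (- u d) * (d \<bullet> v)) = 0" using x0 by simp
    then have "\<forall>d\<in>B. (- u d) * (d \<bullet> v) = 0"
      using AB pos by (subst (asm) sum_nonneg_eq_0_iff) (auto simp: B_def mult_nonpos_nonneg less_imp_le)
    then show ?thesis using w \<open>A = {}\<close> AB pos by fastforce
  qed
  then show ?thesis using \<open>finite D\<close> by (auto simp: dependent_finite)
qed

context irreducible_root_system begin

text \<open>The base consists of the indecomposable positive roots with respect to a generic functional.\<close>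

lemma generating_base:
  "\<exists>D\<subseteq>R. independent D \<and>
    (\<forall>Q. D \<subseteq> Q \<longrightarrow> (\<forall>a\<in>Q. \<forall>b\<in>Q. root_reflection a b \<in> Q) \<longrightarrow> R \<subseteq> Q)"
proof -
  obtain v where v: "\<And>a. a \<in> R \<Longrightarrow> a \<bullet> v \<noteq> 0"
    using generic_functional[OF finite_R zero_notin_R] by blast
  define P where "P = {a\<in>R. a \<bullet> v > 0}"
  define D where "D = {a\<in>P. \<not> (\<exists>b\<in>P. \<exists>c\<in>P. a = b + c)}"
  have PR: "P \<subseteq> R" and DP: "D \<subseteq> P" by (auto simp: P_def D_def)
  have finP: "finite P" using PR finite_R finite_subset by blast
  have P_or: "a \<in> P \<or> - a \<in> P" if "a \<in> R" for a
    using v[OF that] minus_root[OF that] that by (auto simp: P_def)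
  have P_induct: "Q a" if "a \<in> P" and base: "\<And>d. d \<in> D \<Longrightarrow> Q d"
    and step: "\<And>a. a \<in> P \<Longrightarrow> a \<notin> D \<Longrightarrow> (\<And>b. b \<in> P \<Longrightarrow> b \<bullet> v < a \<bullet> v \<Longrightarrow> Q b) \<Longrightarrow> Q a" for Q a
    using \<open>a \<in> P\<close>
  proof (induction "card {b\<in>P. b \<bullet> v < a \<bullet> v}" arbitrary: a rule: less_induct)
    case less
    show ?case
    proof (cases "a \<in> D")
      case False
      show ?thesis
      proof (rule step[OF less.prems False])
        fix b assume b: "b \<in> P" "b \<bullet> v < a \<bullet> v"
        have "{c\<in>P. c \<bullet> v < b \<bullet> v} \<subset> {c\<in>P. c \<bullet> v < a \<bullet> v}" using b by auto
        then have "card {c\<in>P. c \<bullet> v < b \<bullet> v} < card {c\<in>P. c \<bullet> v < a \<bullet> v}"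
          using finP by (intro psubset_card_mono) auto
        then show "Q b" using less.hyps b by blast
      qed
    qed (use base in auto)
  qed
  have P_induct_add: "Q a" if "a \<in> P" and base: "\<And>d. d \<in> D \<Longrightarrow> Q d"
    and add: "\<And>b c. Q b \<Longrightarrow> Q c \<Longrightarrow> Q (b + c)" for Q a
    using that(1)
  proof (rule P_induct)
    fix a assume a: "a \<in> P" "a \<notin> D" and IH: "\<And>b. b \<in> P \<Longrightarrow> b \<bullet> v < a \<bullet> v \<Longrightarrow> Q b"
    then obtain b c where bc: "b \<in> P" "c \<in> P" "a = b + c" by (auto simp: D_def)
    then have "b \<bullet> v < a \<bullet> v" "c \<bullet> v < a \<bullet> v" by (auto simp: P_def inner_add_left)
    then show "Q a" using IH bc add by auto
  qed (use base in auto)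
  have obtuse: "d \<bullet> e \<le> 0" if "d \<in> D" "e \<in> D" "d \<noteq> e" for d e
  proof (rule ccontr)
    assume "\<not> d \<bullet> e \<le> 0"
    then have "d - e \<in> R" using diff_root[of d e] that DP PR by auto
    then have "d - e \<in> P \<or> e - d \<in> P" using P_or[of "d - e"] by simp
    moreover have "d = (d - e) + e" "e = (e - d) + d" by simp_all
    ultimately show False using that DP unfolding D_def by blast
  qed
  have indep: "independent D"
  proof (rule independent_obtuse)
    show "finite D" using DP finP finite_subset by blast
    show "d \<bullet> v > 0" if "d \<in> D" for d using that DP by (auto simp: P_def)
  qed (rule obtuse)
  have reflect_pos: "root_reflection d a \<in> P" if a: "a \<in> P" "a \<noteq> d" and d: "d \<in> D" for a d
  proof (rule ccontr)
    assume neg: "root_reflection d a \<notin> P"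
    have dR: "d \<in> R" "d \<in> P" using d DP PR by auto
    then have "root_reflection d a \<in> R" using reflection_root a PR by auto
    then have neg': "- root_reflection d a \<in> P" using neg P_or by blast
    \<comment> \<open>The functional g adds up the coefficients at the simple roots other than d.
      Reflection in d changes only the coefficient at d, so g is preserved; on positive roots g is
      nonnegative and vanishes only on multiples of d.\<close>
    obtain g :: "'a \<Rightarrow> real" where g: "linear g" "\<And>e. e \<in> D \<Longrightarrow> g e = (if e = d then 0 else 1)"
      using linear_independent_extend[OF indep, of "\<lambda>e. if e = d then 0 else 1"] by blast
    have gP: "0 \<le> g b \<and> (g b = 0 \<longrightarrow> b \<in> span {d})" if "b \<in> P" for b
      using that
    proof (rule P_induct_add)
      show "0 \<le> g e \<and> (g e = 0 \<longrightarrow> e \<in> span {d})" if "e \<in> D" for e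
        using g(2)[OF that] by (auto simp: span_base)
      show "0 \<le> g (b + c) \<and> (g (b + c) = 0 \<longrightarrow> b + c \<in> span {d})"
        if "0 \<le> g b \<and> (g b = 0 \<longrightarrow> b \<in> span {d})" "0 \<le> g c \<and> (g c = 0 \<longrightarrow> c \<in> span {d})" for b c
        using that by (auto simp: linear_add[OF g(1)] add_nonneg_eq_0_iff intro: span_add)
    qed
    have "g (root_reflection d a) = g a"
      using g d by (simp add: root_reflection_def linear_diff linear_scale)
    then have "g a = 0" using gP[OF neg'] gP[OF a(1)] linear_neg[OF g(1)] by simp
    then have "a \<in> span {d}" using gP a by auto
    then obtain k where "a = k *\<^sub>R d" by (auto simp: span_singleton)
    then have "a = d \<or> a = - d" using proportional_roots[of d k] a PR dR by auto
    then show False using a dR by (auto simp: P_def)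
  qed
  have "R \<subseteq> Q" if DQ: "D \<subseteq> Q" and Q: "\<And>a b. a \<in> Q \<Longrightarrow> b \<in> Q \<Longrightarrow> root_reflection a b \<in> Q" for Q
  proof -
    have PQ: "a \<in> Q" if "a \<in> P" for a
      using that
    proof (rule P_induct)
      fix a assume a: "a \<in> P" "a \<notin> D" and IH: "\<And>b. b \<in> P \<Longrightarrow> b \<bullet> v < a \<bullet> v \<Longrightarrow> b \<in> Q"
      \<comment> \<open>The root a is a sum of simple roots, so if it paired nonpositively with all
        of them, \<open>a \<bullet> a\<close> would be nonpositive. Reflecting in such a d lowers
        the value on v, and reflecting once more returns to a.\<close>
      have "\<exists>d\<in>D. a \<bullet> d > 0"
      proof (rule ccontr)
        assume "\<not> (\<exists>d\<in>D. a \<bullet> d > 0)"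
        then have "a \<bullet> a \<le> 0"
          using a(1) by - (rule P_induct_add[of a "\<lambda>b. a \<bullet> b \<le> 0"], auto simp: inner_add_right not_less)
        then show False using inner_pos[of a] a PR by (auto simp del: inner_gt_zero_iff)
      qed
      then obtain d where d: "d \<in> D" "a \<bullet> d > 0" by blast
      have dR: "d \<in> R" "d \<in> P" using d DP PR by auto
      define b where "b = root_reflection d a"
      have "b \<in> P" using reflect_pos[of a d] a d by (auto simp: b_def)
      moreover have "b \<bullet> v < a \<bullet> v"
        using d dR inner_pos[of d]
        by (simp add: b_def root_reflection_def inner_diff_left cartan_int_eq P_def)
      ultimately have "b \<in> Q" by (rule IH)
      then have "root_reflection d b \<in> Q" using Q d DQ by auto
      then show "a \<in> Q" by (simp add: b_def)
    qed (use DQ in auto)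
    show "R \<subseteq> Q"
    proof
      fix a assume "a \<in> R"
      then consider "a \<in> P" | "- a \<in> P" using P_or by blast
      then show "a \<in> Q"
      proof cases
        case 2
        then have "root_reflection (- a) (- a) \<in> Q" using PQ Q by blast
        then show ?thesis using root_reflection_self[of "- a"] root_nonzero[OF \<open>a \<in> R\<close>] by simp
      qed (rule PQ)
    qed
  qed
  then show ?thesis using indep DP PR by (intro exI[of _ D]) blast
qed

end

section \<open>Weyl group orbits and root lengths\<close>

context irreducible_root_system begin

text \<open>The orbit of \<alpha> under the Weyl group, generated one reflection at a time.\<close>

inductive_set orbit :: "'a \<Rightarrow> 'a set" for \<alpha> where
  base: "\<alpha> \<in> orbit \<alpha>"
| reflect: "\<beta> \<in> orbit \<alpha> \<Longrightarrow> \<gamma> \<in> R \<Longrightarrow> root_reflection \<gamma> \<beta> \<in> orbit \<alpha>"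

lemma orbit_root: "\<beta> \<in> orbit \<alpha> \<Longrightarrow> \<alpha> \<in> R \<Longrightarrow> \<beta> \<in> R"
  by (induction rule: orbit.induct) (auto intro: reflection_root)

lemma orbit_norm: "\<beta> \<in> orbit \<alpha> \<Longrightarrow> norm \<beta> = norm \<alpha>"
  by (induction rule: orbit.induct) auto

text \<open>Otherwise R splits into the roots that some orbit element sees and those orthogonal to
  the whole orbit. If \<gamma> in the orbit sees a, then \<gamma> and its reflection in a are both
  orthogonal to b, hence so is their difference, a nonzero multiple of a. The lemma replaces a root
  by one of the same length that is not orthogonal to a given root.\<close>

lemma orbit_not_orthogonal:
  assumes "\<alpha> \<in> R" "\<beta> \<in> R"
  shows "\<exists>\<gamma>\<in>orbit \<alpha>. \<gamma> \<bullet> \<beta> \<noteq> 0"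
proof (rule ccontr)
  assume no: "\<not> ?thesis"
  define A where "A = {\<delta>\<in>R. \<exists>\<gamma>\<in>orbit \<alpha>. \<gamma> \<bullet> \<delta> \<noteq> 0}"
  have 1: "\<alpha> \<in> A" using assms orbit.base[of \<alpha>] root_nonzero[of \<alpha>] by (auto simp: A_def intro!: bexI[of _ \<alpha>])
  have 2: "\<beta> \<in> R - A" using no assms by (auto simp: A_def)
  have 3: "a \<bullet> b = 0" if ab: "a \<in> A" "b \<in> R - A" for a b
  proof -
    obtain \<gamma> where \<gamma>: "\<gamma> \<in> orbit \<alpha>" "\<gamma> \<bullet> a \<noteq> 0" and a: "a \<in> R" using ab by (auto simp: A_def)
    have "root_reflection a \<gamma> \<in> orbit \<alpha>" using \<gamma> a by (intro orbit.reflect)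
    then have "\<gamma> \<bullet> b = 0" "root_reflection a \<gamma> \<bullet> b = 0" using ab \<gamma> by (auto simp: A_def)
    then have "cartan_int \<gamma> a * (a \<bullet> b) = 0" by (simp add: root_reflection_def inner_diff_left)
    then show ?thesis using \<gamma> root_nonzero[OF a] by (simp add: cartan_int_eq)
  qed
  have "\<exists>A B. A \<noteq> {} \<and> B \<noteq> {} \<and> A \<union> B = R \<and> A \<inter> B = {} \<and> (\<forall>a\<in>A. \<forall>b\<in>B. a \<bullet> b = 0)"
  proof (intro exI conjI)
    show "A \<noteq> {}" "R - A \<noteq> {}" using 1 2 by blast+
    show "A \<union> (R - A) = R" "A \<inter> (R - A) = {}" by (auto simp: A_def)
    show "\<forall>a\<in>A. \<forall>b\<in>R - A. a \<bullet> b = 0" using 3 by blast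
  qed
  then show False using irreducible unfolding irreducible_rs_def by metis
qed

text \<open>Reduced to \<open>cartan_int_cases\<close> by moving \<alpha> within its orbit until it
  is not orthogonal to \<beta>.\<close>

lemma norm_ratio:
  assumes "\<alpha> \<in> R" "\<beta> \<in> R" "norm \<alpha> \<le> norm \<beta>"
  shows "(\<beta> \<bullet> \<beta>) / (\<alpha> \<bullet> \<alpha>) \<in> {1, 2, 3}"
proof -
  obtain \<gamma> where \<gamma>: "\<gamma> \<in> orbit \<alpha>" "\<gamma> \<bullet> \<beta> \<noteq> 0" using orbit_not_orthogonal assms by blast
  have n: "norm \<gamma> = norm \<alpha>" and R: "\<gamma> \<in> R" using \<gamma> orbit_norm orbit_root assms by auto
  then have i: "\<gamma> \<bullet> \<gamma> = \<alpha> \<bullet> \<alpha>" by (simp add: norm_eq)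
  show ?thesis
  proof (cases "\<beta> = \<gamma> \<or> \<beta> = - \<gamma>")
    case True
    then show ?thesis using i root_nonzero[OF assms(1)] by auto
  next
    case False
    then show ?thesis using cartan_int_cases(2)[of \<gamma> \<beta>] R assms \<gamma> n i by simp
  qed
qed

text \<open>A third, smaller length would give two successive ratios of squared lengths, each at
  least 2, whose product must again be at most 3. This reconciles \<open>short_roots\<close>,
  defined as the roots of non-maximal length, with minimal length.\<close>

lemma nonmaximal_imp_minimal:
  assumes "\<alpha> \<in> R" "\<beta> \<in> R" "\<gamma> \<in> R" "norm \<alpha> < norm \<beta>"
  shows "norm \<alpha> \<le> norm \<gamma>"
proof (rule ccontr)
  assume "\<not> ?thesis"
  then have lt: "norm \<gamma> < norm \<alpha>" by simp
  have pos: "\<alpha> \<bullet> \<alpha> > 0" "\<gamma> \<bullet> \<gamma> > 0" using inner_pos assms by auto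
  have "\<gamma> \<bullet> \<gamma> < \<alpha> \<bullet> \<alpha>" "\<alpha> \<bullet> \<alpha> < \<beta> \<bullet> \<beta>" using lt assms(4) by (simp_all add: norm_lt)
  moreover have "\<beta> \<bullet> \<beta> \<in> {1 * (\<alpha> \<bullet> \<alpha>), 2 * (\<alpha> \<bullet> \<alpha>), 3 * (\<alpha> \<bullet> \<alpha>)}"
    "\<alpha> \<bullet> \<alpha> \<in> {1 * (\<gamma> \<bullet> \<gamma>), 2 * (\<gamma> \<bullet> \<gamma>), 3 * (\<gamma> \<bullet> \<gamma>)}"
    "\<beta> \<bullet> \<beta> \<in> {1 * (\<gamma> \<bullet> \<gamma>), 2 * (\<gamma> \<bullet> \<gamma>), 3 * (\<gamma> \<bullet> \<gamma>)}"
    using norm_ratio[of \<alpha> \<beta>] norm_ratio[of \<gamma> \<alpha>] norm_ratio[of \<gamma> \<beta>] assms lt pos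
    by (simp_all add: divide_eq_eq)
  ultimately show False using pos by auto
qed

end

section \<open>Reflection families\<close>

text \<open>Both an extension datum and the translates of the fibres of a subroot system
  have this property.\<close>

definition reflection_family ::
    "'a::euclidean_space set \<Rightarrow> ('a \<Rightarrow> 'y::real_vector set) \<Rightarrow> bool"
  where "reflection_family R F \<longleftrightarrow>
    (\<forall>\<alpha>\<in>R. 0 \<in> F \<alpha>) \<and>
    (\<forall>\<alpha>\<in>R. \<forall>\<beta>\<in>R. \<forall>y\<in>F \<alpha>. \<forall>z\<in>F \<beta>.
       z - cartan_int \<beta> \<alpha> *\<^sub>R y \<in> F (root_reflection \<alpha> \<beta>))"

lemma reflection_familyD:
  assumes "reflection_family R F" "\<alpha> \<in> R"
  shows "0 \<in> F \<alpha>"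
    and "\<beta> \<in> R \<Longrightarrow> y \<in> F \<alpha> \<Longrightarrow> z \<in> F \<beta> \<Longrightarrow> z - cartan_int \<beta> \<alpha> *\<^sub>R y \<in> F (root_reflection \<alpha> \<beta>)"
  using assms by (auto simp: reflection_family_def)

definition additive_subgroup :: "'a::ab_group_add set \<Rightarrow> bool"
  where "additive_subgroup H \<longleftrightarrow> 0 \<in> H \<and> (\<forall>x\<in>H. \<forall>y\<in>H. x - y \<in> H)"

lemma additive_subgroup_zero: "additive_subgroup H \<Longrightarrow> 0 \<in> H"
  and additive_subgroup_diff: "additive_subgroup H \<Longrightarrow> x \<in> H \<Longrightarrow> y \<in> H \<Longrightarrow> x - y \<in> H"
  by (auto simp: additive_subgroup_def)

lemma additive_subgroup_minus: "additive_subgroup H \<Longrightarrow> x \<in> H \<Longrightarrow> - x \<in> H"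
  using additive_subgroup_diff[of H 0 x] additive_subgroup_zero by auto

lemma additive_subgroup_add: "additive_subgroup H \<Longrightarrow> x \<in> H \<Longrightarrow> y \<in> H \<Longrightarrow> x + y \<in> H"
  using additive_subgroup_diff[of H x "- y"] additive_subgroup_minus by auto

text \<open>Cartan integers have type \<open>real\<close>; this lets subgroups absorb multiplication
  by them.\<close>

lemma additive_subgroup_scale:
  fixes H :: "'y::real_vector set"
  assumes "additive_subgroup H" "x \<in> H" "k \<in> \<int>"
  shows "k *\<^sub>R x \<in> H"
proof -
  have nat: "real n *\<^sub>R x \<in> H" for n
    by (induction n)
       (auto simp: scaleR_add_left additive_subgroup_zero additive_subgroup_add assms)
  obtain m where m: "k = of_int m" using assms by (auto elim: Ints_cases)
  show ?thesis
  proof (cases "m \<ge> 0")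
    case True
    then show ?thesis using nat[of "nat m"] m by simp
  next
    case False
    then show ?thesis using additive_subgroup_minus[OF assms(1) nat[of "nat (- m)"]] m by simp
  qed
qed

context irreducible_root_system begin

context
  fixes F :: "'a \<Rightarrow> 'y::real_vector set"
  assumes fam: "reflection_family R F"
begin

text \<open>Taking y = 0 in the reflection axiom gives one inclusion; the reflection is an
  involution, which gives the other.\<close>

lemma family_reflection:
  assumes "\<alpha> \<in> R" "\<beta> \<in> R"
  shows "F (root_reflection \<alpha> \<beta>) = F \<beta>"
proof -
  have *: "F b \<subseteq> F (root_reflection \<alpha> b)" if "b \<in> R" for b
    using reflection_familyD(2)[OF fam assms(1) that reflection_familyD(1)[OF fam assms(1)]] by auto
  show ?thesis
    using *[of \<beta>] *[of "root_reflection \<alpha> \<beta>"] assms reflection_root by auto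
qed

lemma family_orbit: "\<beta> \<in> orbit \<alpha> \<Longrightarrow> \<alpha> \<in> R \<Longrightarrow> F \<beta> = F \<alpha>"
  by (induction rule: orbit.induct) (auto simp: family_reflection orbit_root)

lemma family_minus: "\<alpha> \<in> R \<Longrightarrow> F (- \<alpha>) = F \<alpha>"
  using family_reflection[of \<alpha> \<alpha>] root_reflection_self[of \<alpha>] root_nonzero by auto

lemma family_uminus:
  assumes "\<alpha> \<in> R" "y \<in> F \<alpha>"
  shows "- y \<in> F \<alpha>"
proof -
  have "y - cartan_int \<alpha> \<alpha> *\<^sub>R y \<in> F (root_reflection \<alpha> \<alpha>)"
    using reflection_familyD(2)[OF fam] assms by auto
  moreover have "cartan_int \<alpha> \<alpha> = 2" by (rule cartan_int_self) (use assms root_nonzero in auto)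
  ultimately show ?thesis using assms family_reflection by (simp add: scaleR_2)
qed

text \<open>Move \<alpha> within its orbit to some \<gamma> not orthogonal to \<beta>. Unless they
  are proportional, equal length makes both Cartan integers the same sign 1 or -1, so the reflection
  of \<beta> in \<gamma> equals that of \<gamma> in \<beta> up to sign.\<close>

lemma family_norm:
  assumes "\<alpha> \<in> R" "\<beta> \<in> R" "norm \<alpha> = norm \<beta>"
  shows "F \<alpha> = F \<beta>"
proof -
  obtain \<gamma> where \<gamma>: "\<gamma> \<in> orbit \<alpha>" "\<gamma> \<bullet> \<beta> \<noteq> 0" using orbit_not_orthogonal assms by blast
  have n: "norm \<gamma> = norm \<beta>" and R: "\<gamma> \<in> R" and F: "F \<gamma> = F \<alpha>"
    using \<gamma> orbit_norm orbit_root family_orbit assms by auto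
  consider "\<beta> = \<gamma>" | "\<beta> = - \<gamma>" | "\<beta> \<noteq> \<gamma>" "\<beta> \<noteq> - \<gamma>" by blast
  then have "F \<gamma> = F \<beta>"
  proof cases
    case 3
    then have c: "cartan_int \<gamma> \<beta> \<in> {1, -1}" using cartan_int_cases(1) R assms n \<gamma> by simp
    have "\<gamma> \<bullet> \<gamma> = \<beta> \<bullet> \<beta>" using n by (simp add: norm_eq)
    then have "cartan_int \<beta> \<gamma> = cartan_int \<gamma> \<beta>" by (simp add: cartan_int_eq inner_commute)
    then have "root_reflection \<gamma> \<beta> = root_reflection \<beta> \<gamma> \<or> root_reflection \<gamma> \<beta> = - root_reflection \<beta> \<gamma>"
      using c by (auto simp: root_reflection_def)
    then show ?thesis
      using family_reflection[OF R assms(2)] family_reflection[OF assms(2) R]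
        family_minus[OF reflection_root[OF assms(2) R]] by auto
  qed (use family_minus R in auto)
  then show ?thesis using F by simp
qed

end

text \<open>Some root \<alpha> in the orbit of \<sigma>, up to sign, has Cartan integer 1 against
  \<beta>. Then \<open>\<beta> - \<alpha>\<close> is the negative of the reflection of \<alpha> in
  \<beta>, so it is a root of the same length as \<alpha>.\<close>

lemma sum_of_shorter:
  assumes "\<sigma> \<in> R" "\<beta> \<in> R" "norm \<sigma> < norm \<beta>"
  shows "\<exists>\<alpha>\<in>R. \<exists>\<alpha>'\<in>R. norm \<alpha> = norm \<sigma> \<and> norm \<alpha>' = norm \<sigma> \<and> \<beta> = \<alpha> + \<alpha>'"
proof -
  obtain \<gamma> where \<gamma>: "\<gamma> \<in> orbit \<sigma>" "\<gamma> \<bullet> \<beta> \<noteq> 0" using orbit_not_orthogonal assms by blast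
  have n: "norm \<gamma> = norm \<sigma>" and R: "\<gamma> \<in> R" using \<gamma> orbit_norm orbit_root assms by auto
  then have "cartan_int \<gamma> \<beta> \<in> {1, -1}"
    using assms \<gamma> by (intro cartan_int_cases(1)) auto
  then obtain \<alpha> where \<alpha>: "\<alpha> \<in> R" "norm \<alpha> = norm \<sigma>" "cartan_int \<alpha> \<beta> = 1"
    using R n minus_root[OF R] by (metis cartan_int_minus_left equation_minus_iff insertE norm_minus_cancel singletonD)
  have r: "root_reflection \<beta> \<alpha> = \<alpha> - \<beta>" using \<alpha> by (simp add: root_reflection_def)
  then have "\<beta> - \<alpha> \<in> R" using minus_root[OF reflection_root[OF assms(2) \<alpha>(1)]] by simp
  moreover have "norm (\<beta> - \<alpha>) = norm \<sigma>" using norm_root_reflection[of \<beta> \<alpha>] r \<alpha> by (simp add: norm_minus_commute)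
  ultimately show ?thesis using \<alpha> by (intro bexI[of _ \<alpha>] bexI[of _ "\<beta> - \<alpha>"]) auto
qed

end

text \<open>This covers exactly the simply-laced types of rank at least 2, \<open>C\<^sub>n\<close> for \<open>n \<ge> 3\<close>,
  \<open>F\<^sub>4\<close> and \<open>G\<^sub>2\<close>: the roots of minimal length contain a subsystem of type \<open>A\<^sub>2\<close>.\<close>

locale root_system_with_minimal_A2 = irreducible_root_system +
  fixes \<sigma> \<sigma>' :: 'a
  assumes \<sigma>: "\<sigma> \<in> R" and \<sigma>': "\<sigma>' \<in> R"
    and norm_\<sigma>': "norm \<sigma>' = norm \<sigma>"
    and cartan_\<sigma>'_\<sigma>: "cartan_int \<sigma>' \<sigma> = 1"
    and \<sigma>_minimal: "\<alpha> \<in> R \<Longrightarrow> norm \<sigma> \<le> norm \<alpha>"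
begin

context
  fixes F :: "'a \<Rightarrow> 'y::real_vector set"
  assumes fam: "reflection_family R F"
begin

text \<open>Reflecting \<sigma>' in \<sigma> has coefficient 1, so the axiom produces
  \<open>z - y\<close>, and all three roots involved have the same fibre.\<close>

lemma family_subgroup: "additive_subgroup (F \<sigma>)"
  unfolding additive_subgroup_def
proof (intro conjI ballI)
  show "0 \<in> F \<sigma>" using reflection_familyD(1)[OF fam \<sigma>] .
  fix z y assume "z \<in> F \<sigma>" "y \<in> F \<sigma>"
  moreover have F: "F \<sigma>' = F \<sigma>" using family_norm[OF fam \<sigma>' \<sigma> norm_\<sigma>'] .
  ultimately show "z - y \<in> F \<sigma>"
    using reflection_familyD(2)[OF fam \<sigma> \<sigma>', of y z] family_reflection[OF fam \<sigma> \<sigma>'] F cartan_\<sigma>'_\<sigma>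
    by simp
qed

text \<open>A longer root has a conjugate \<gamma> against which \<sigma> has Cartan integer 1 or
  -1. Reflecting the element 0 over \<sigma> by y over \<gamma> puts y, up to sign, into the fibre
  over \<sigma>.\<close>

lemma family_subset:
  assumes "\<alpha> \<in> R"
  shows "F \<alpha> \<subseteq> F \<sigma>"
proof (cases "norm \<alpha> = norm \<sigma>")
  case True
  then show ?thesis using family_norm[OF fam assms \<sigma>] by simp
next
  case False
  then have lt: "norm \<sigma> < norm \<alpha>" using \<sigma>_minimal[OF assms] by simp
  obtain \<gamma> where \<gamma>: "\<gamma> \<in> orbit \<alpha>" "\<gamma> \<bullet> \<sigma> \<noteq> 0" using orbit_not_orthogonal assms \<sigma> by blast
  have n: "norm \<gamma> = norm \<alpha>" and R: "\<gamma> \<in> R" and F: "F \<gamma> = F \<alpha>"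
    using \<gamma> orbit_norm orbit_root family_orbit[OF fam] assms by auto
  have c: "cartan_int \<sigma> \<gamma> \<in> {1, -1}"
    using n lt \<gamma> R \<sigma> by (intro cartan_int_cases(1)) (auto simp: inner_commute)
  show ?thesis
  proof
    fix y assume "y \<in> F \<alpha>"
    then have "0 - cartan_int \<sigma> \<gamma> *\<^sub>R y \<in> F \<sigma>"
      using reflection_familyD(2)[OF fam R \<sigma>] family_reflection[OF fam R \<sigma>] F
        reflection_familyD(1)[OF fam \<sigma>] by metis
    then show "y \<in> F \<sigma>" using c family_uminus[OF fam \<sigma>, of "- y"] by auto
  qed
qed

end

end

section \<open>Closed subroot systems with full gradient\<close>

text \<open>The system of the theorem for \<open>\<tau> \<alpha> = p \<alpha> + H\<close>, written
  uniformly for both lengths: where \<open>L \<alpha>\<close> equals \<open>L \<sigma>\<close>, the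
  condition \<open>y \<in> L \<alpha>\<close> follows from the coset condition, provided that
  \<open>p \<alpha>\<close> and H lie in the group \<open>L \<sigma>\<close>.\<close>

definition coset_system ::
    "'a set \<Rightarrow> ('a \<Rightarrow> 'y::real_vector set) \<Rightarrow> ('a \<Rightarrow> 'y) \<Rightarrow> 'y set \<Rightarrow> ('a \<times> 'y) set"
  where "coset_system R L p H = {(\<alpha>, y). \<alpha> \<in> R \<and> y \<in> L \<alpha> \<and> y - p \<alpha> \<in> H}"

lemma mem_coset_system [simp]:
  "(\<alpha>, y) \<in> coset_system R L p H \<longleftrightarrow> \<alpha> \<in> R \<and> y \<in> L \<alpha> \<and> y - p \<alpha> \<in> H"
  by (simp add: coset_system_def)

text \<open>This is the rule by which \<open>affine_reflection\<close> acts on second components, so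
  translating fibres by a linear map respects reflections.\<close>

lemma linear_root_reflection:
  "linear p \<Longrightarrow> p (root_reflection \<alpha> \<beta>) = p \<beta> - cartan_int \<beta> \<alpha> *\<^sub>R p \<alpha>"
  by (simp add: root_reflection_def linear_diff linear_scale)

definition maximal_in :: "'y::ab_group_add set \<Rightarrow> 'y set \<Rightarrow> bool"
  where "maximal_in S H \<longleftrightarrow> additive_subgroup H \<and> H \<subset> S \<and>
    (\<forall>K. additive_subgroup K \<and> H \<subset> K \<and> K \<subseteq> S \<longrightarrow> K = S)"

context root_system_with_minimal_A2 begin

context
  fixes L :: "'a \<Rightarrow> 'y::real_vector set"
  assumes L: "reflection_family R L"
begin

text \<open>Fibres over longer roots are recovered by writing such a root as a sum of two roots of
  minimal length.\<close>

lemma closed_full_imp_coset_system: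
  assumes cl: "closed_subroot_system R L \<Psi>" and gr: "gradient R L \<Psi> = R"
  shows "\<exists>p H. linear p \<and> additive_subgroup H \<and> H \<subseteq> L \<sigma> \<and> (\<forall>\<alpha>\<in>R. p \<alpha> \<in> L \<alpha>) \<and>
    \<Psi> = coset_system R L p H"
proof -
  define Z where "Z \<alpha> = {y. (\<alpha>, y) \<in> \<Psi>}" for \<alpha>
  have sub: "\<Psi> \<subseteq> real_roots R L" using cl by (auto simp: closed_subroot_system_def subroot_system_def)
  have ZL: "Z \<alpha> \<subseteq> L \<alpha>" for \<alpha> using sub by (auto simp: Z_def real_roots_def)
  have ZR: "\<alpha> \<in> R" if "y \<in> Z \<alpha>" for \<alpha> y using that sub by (auto simp: Z_def real_roots_def)
  have Zrefl: "z - cartan_int \<beta> \<alpha> *\<^sub>R y \<in> Z (root_reflection \<alpha> \<beta>)" if "y \<in> Z \<alpha>" "z \<in> Z \<beta>" for \<alpha> \<beta> y z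
  proof -
    have "affine_reflection (\<alpha>, y) (\<beta>, z) \<in> \<Psi>"
      using that cl unfolding Z_def closed_subroot_system_def subroot_system_def by blast
    then show ?thesis by (simp add: Z_def)
  qed
  have Zadd: "y + z \<in> Z (\<alpha> + \<beta>)"
    if "y \<in> Z \<alpha>" "z \<in> Z \<beta>" "\<alpha> + \<beta> \<in> R" "y + z \<in> L (\<alpha> + \<beta>)" for \<alpha> \<beta> y z
  proof -
    have "(\<alpha>, y) \<in> \<Psi>" "(\<beta>, z) \<in> \<Psi>" "(\<alpha>, y) + (\<beta>, z) \<in> real_roots R L"
      using that by (auto simp: Z_def real_roots_def)
    then have "(\<alpha>, y) + (\<beta>, z) \<in> \<Psi>" using cl unfolding closed_subroot_system_def by blast
    then show ?thesis by (simp add: Z_def)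
  qed
  have "\<exists>y. y \<in> Z \<alpha>" if "\<alpha> \<in> R" for \<alpha> using gr that by (auto simp: gradient_def Z_def)
  then obtain q where q: "\<And>\<alpha>. \<alpha> \<in> R \<Longrightarrow> q \<alpha> \<in> Z \<alpha>" by metis
  obtain D where D: "D \<subseteq> R" "independent D"
    and gen: "\<And>Q. D \<subseteq> Q \<Longrightarrow> \<forall>a\<in>Q. \<forall>b\<in>Q. root_reflection a b \<in> Q \<Longrightarrow> R \<subseteq> Q"
    using generating_base by blast
  obtain p where p: "linear p" "\<And>d. d \<in> D \<Longrightarrow> p d = q d"
    using linear_independent_extend[OF D(2), of q] by blast
  have "R \<subseteq> {\<alpha>. p \<alpha> \<in> Z \<alpha>}"
    by (rule gen) (use D q p in \<open>auto simp: linear_root_reflection Zrefl subset_eq\<close>)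
  then have pZ: "p \<alpha> \<in> Z \<alpha>" if "\<alpha> \<in> R" for \<alpha> using that by auto
  define F where "F \<alpha> = {y. y + p \<alpha> \<in> Z \<alpha>}" for \<alpha>
  have fam: "reflection_family R F"
    unfolding reflection_family_def
  proof (intro conjI ballI)
    show "0 \<in> F \<alpha>" if "\<alpha> \<in> R" for \<alpha> using pZ that by (simp add: F_def)
    show "z - cartan_int \<beta> \<alpha> *\<^sub>R y \<in> F (root_reflection \<alpha> \<beta>)"
      if "\<alpha> \<in> R" "\<beta> \<in> R" "y \<in> F \<alpha>" "z \<in> F \<beta>" for \<alpha> \<beta> y z
      using Zrefl[of "y + p \<alpha>" \<alpha> "z + p \<beta>" \<beta>] that
      by (simp add: F_def linear_root_reflection p scaleR_add_right algebra_simps)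
  qed
  note S = family_subgroup[OF L]
  have p\<sigma>: "p \<sigma> \<in> L \<sigma>" using pZ \<sigma> ZL by auto
  have FS: "F \<sigma> \<subseteq> L \<sigma>"
  proof
    fix y assume "y \<in> F \<sigma>"
    then have "y + p \<sigma> \<in> L \<sigma>" using ZL by (auto simp: F_def)
    then show "y \<in> L \<sigma>" using additive_subgroup_diff[OF S _ p\<sigma>] by fastforce
  qed
  have Zeq: "y \<in> Z \<beta> \<longleftrightarrow> y \<in> L \<beta> \<and> y - p \<beta> \<in> F \<sigma>" if \<beta>: "\<beta> \<in> R" for \<beta> y
  proof
    assume y: "y \<in> Z \<beta>"
    then have "y - p \<beta> \<in> F \<beta>" by (simp add: F_def)
    then show "y \<in> L \<beta> \<and> y - p \<beta> \<in> F \<sigma>" using y ZL family_subset[OF fam \<beta>] by auto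
  next
    assume y: "y \<in> L \<beta> \<and> y - p \<beta> \<in> F \<sigma>"
    show "y \<in> Z \<beta>"
    proof (cases "norm \<sigma> = norm \<beta>")
      case True
      then have "F \<sigma> = F \<beta>" using family_norm[OF fam \<sigma> \<beta>] by simp
      then show ?thesis using y by (simp add: F_def)
    next
      case False
      then obtain a b where ab: "a \<in> R" "b \<in> R" "norm a = norm \<sigma>" "norm b = norm \<sigma>" "\<beta> = a + b"
        using sum_of_shorter[OF \<sigma> \<beta>] \<sigma>_minimal[OF \<beta>] by auto
      have "F b = F \<sigma>" using family_norm[OF fam ab(2) \<sigma> ab(4)] .
      \<comment> \<open>The whole deviation \<open>y - p \<beta>\<close> is placed on the summand b.
        Adding \<open>p a\<close> over a then gives exactly y, because p is additive.\<close>
      then have "y - p \<beta> + p b \<in> Z b" using y by (auto simp: F_def)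
      then have "p a + (y - p \<beta> + p b) \<in> Z (a + b)"
        using pZ ab y \<beta> by (intro Zadd) (auto simp: linear_add[OF p(1)])
      then show ?thesis using ab by (simp add: linear_add[OF p(1)])
    qed
  qed
  have "\<Psi> = coset_system R L p (F \<sigma>)"
  proof (rule Set.set_eqI)
    fix x :: "'a \<times> 'y"
    obtain \<alpha> y where "x = (\<alpha>, y)" by (cases x)
    then show "x \<in> \<Psi> \<longleftrightarrow> x \<in> coset_system R L p (F \<sigma>)"
      using Zeq[of \<alpha> y] ZR[of y \<alpha>] by (auto simp: Z_def)
  qed
  then show ?thesis
    using p FS family_subgroup[OF fam] subsetD[OF ZL pZ] by (intro exI[of _ p] exI[of _ "F \<sigma>"]) auto
qed

text \<open>After subtracting p, reflections and sums become integer combinations of elements of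
  H.\<close>

lemma coset_system_closed_full:
  assumes p: "linear p" "\<And>\<alpha>. \<alpha> \<in> R \<Longrightarrow> p \<alpha> \<in> L \<sigma>"
    and H: "additive_subgroup H" "H \<subset> L \<sigma>"
    and ex: "\<And>\<alpha>. \<alpha> \<in> R \<Longrightarrow> \<exists>y\<in>L \<alpha>. y - p \<alpha> \<in> H"
  shows "closed_subroot_system R L (coset_system R L p H)" "gradient R L (coset_system R L p H) = R"
proof -
  let ?\<Psi> = "coset_system R L p H"
  show "gradient R L ?\<Psi> = R" using ex by (auto simp: gradient_def)
  \<comment> \<open>Properness: shifting \<open>p \<sigma>\<close> by an element of
    \<open>L \<sigma>\<close> outside H leaves the coset over \<sigma>.\<close>
  obtain h where h: "h \<in> L \<sigma>" "h \<notin> H" using H by auto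
  have "h + p \<sigma> \<in> L \<sigma>" using additive_subgroup_add[OF family_subgroup[OF L]] h p \<sigma> by auto
  then have "(\<sigma>, h + p \<sigma>) \<in> real_roots R L - ?\<Psi>" using h \<sigma> by (simp add: real_roots_def)
  moreover have "?\<Psi> \<subseteq> real_roots R L" by (auto simp: real_roots_def coset_system_def)
  ultimately have "?\<Psi> \<subset> real_roots R L" by blast
  moreover have "?\<Psi> \<noteq> {}" using ex[OF \<sigma>] \<sigma> by (auto simp: coset_system_def)
  moreover have "affine_reflection x z \<in> ?\<Psi>" if "x \<in> ?\<Psi>" "z \<in> ?\<Psi>" for x z
  proof -
    obtain \<alpha> y where x: "x = (\<alpha>, y)" by (cases x)
    obtain \<beta> w where z: "z = (\<beta>, w)" by (cases z)
    have A: "\<alpha> \<in> R" "\<beta> \<in> R" "y \<in> L \<alpha>" "w \<in> L \<beta>" "y - p \<alpha> \<in> H" "w - p \<beta> \<in> H"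
      using that x z by auto
    have "(w - p \<beta>) - cartan_int \<beta> \<alpha> *\<^sub>R (y - p \<alpha>) \<in> H"

      by (rule additive_subgroup_diff[OF H(1) A(6)
            additive_subgroup_scale[OF H(1) A(5) cartan_int_Ints[OF A(1,2)]]])
    then have "(w - cartan_int \<beta> \<alpha> *\<^sub>R y) - p (root_reflection \<alpha> \<beta>) \<in> H"
      by (simp add: linear_root_reflection p scaleR_diff_right algebra_simps)
    then show ?thesis
      using A reflection_root[OF A(1,2)] reflection_familyD(2)[OF L A(1,2,3,4)] by (simp add: x z)
  qed
  moreover have "x + z \<in> ?\<Psi>" if xz: "x \<in> ?\<Psi>" "z \<in> ?\<Psi>" "x + z \<in> real_roots R L" for x z
  proof -
    obtain \<alpha> y where x: "x = (\<alpha>, y)" by (cases x)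
    obtain \<beta> w where z: "z = (\<beta>, w)" by (cases z)
    have "(y - p \<alpha>) + (w - p \<beta>) \<in> H"
      using xz x z by (intro additive_subgroup_add[OF H(1)]) auto
    then show ?thesis
      using xz by (simp add: x z real_roots_def linear_add[OF p(1)] algebra_simps)
  qed
  ultimately show "closed_subroot_system R L ?\<Psi>"
    unfolding closed_subroot_system_def subroot_system_def by blast
qed

text \<open>From left to right, a group strictly between H and \<open>L \<sigma>\<close> would give,
  with the same p, a system strictly between. Conversely, a larger closed system also has full
  gradient, hence has its own p' and H'. The fibre over \<sigma> shows that H' contains H,
  maximality gives equality, and equal cosets follow because every fibre of the smaller system is
  nonempty.\<close>

lemma maximal_closed_iff_coset_system:
  "maximal_closed_subroot_system R L \<Psi> \<and> gradient R L \<Psi> = R \<longleftrightarrow>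
    (\<exists>p H. linear p \<and> (\<forall>\<alpha>\<in>R. p \<alpha> \<in> L \<sigma>) \<and> maximal_in (L \<sigma>) H \<and>
      (\<forall>\<alpha>\<in>R. \<exists>y\<in>L \<alpha>. y - p \<alpha> \<in> H) \<and> \<Psi> = coset_system R L p H)" (is "?lhs \<longleftrightarrow> ?rhs")
proof
  assume ?lhs
  then have cl: "closed_subroot_system R L \<Psi>" and gr: "gradient R L \<Psi> = R"
    and mx: "\<And>\<Psi>'. closed_subroot_system R L \<Psi>' \<Longrightarrow> \<Psi> \<subset> \<Psi>' \<Longrightarrow> \<Psi>' \<subset> real_roots R L \<Longrightarrow> False"
    by (auto simp: maximal_closed_subroot_system_def)
  obtain p H where p: "linear p" "\<And>\<alpha>. \<alpha> \<in> R \<Longrightarrow> p \<alpha> \<in> L \<alpha>"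
    and H: "additive_subgroup H" "H \<subseteq> L \<sigma>" and \<Psi>: "\<Psi> = coset_system R L p H"
    using closed_full_imp_coset_system[OF cl gr] by blast
  have pS: "p \<alpha> \<in> L \<sigma>" if "\<alpha> \<in> R" for \<alpha> using p(2) that family_subset[OF L that] by auto
  note S = family_subgroup[OF L]
  have ex: "\<exists>y\<in>L \<alpha>. y - p \<alpha> \<in> H" if "\<alpha> \<in> R" for \<alpha>
    using p(2)[OF that] additive_subgroup_zero[OF H(1)] by (intro bexI[of _ "p \<alpha>"]) auto
  have "H \<noteq> L \<sigma>"
  proof
    assume eq: "H = L \<sigma>"
    have "real_roots R L \<subseteq> \<Psi>"
      using pS family_subset[OF L, THEN subsetD] additive_subgroup_diff[OF S]
      by (auto simp: real_roots_def \<Psi> eq)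
    then show False using cl by (auto simp: closed_subroot_system_def subroot_system_def)
  qed
  then have HS: "H \<subset> L \<sigma>" using H by auto
  have "K = L \<sigma>" if K: "additive_subgroup K" "H \<subset> K" "K \<subseteq> L \<sigma>" for K
  proof (rule ccontr)
    assume ne: "K \<noteq> L \<sigma>"
    have clK: "closed_subroot_system R L (coset_system R L p K)"
      using p pS K ne ex by (intro coset_system_closed_full) blast+
    obtain k where k: "k \<in> K" "k \<notin> H" using K by auto
    have "k + p \<sigma> \<in> L \<sigma>" using additive_subgroup_add[OF S] k K pS[OF \<sigma>] by auto
    then have "(\<sigma>, k + p \<sigma>) \<in> coset_system R L p K - \<Psi>" using k \<sigma> by (simp add: \<Psi>)
    moreover have "\<Psi> \<subseteq> coset_system R L p K" using K by (auto simp: \<Psi> coset_system_def)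
    ultimately have "\<Psi> \<subset> coset_system R L p K" by auto
    then show False
      using mx[OF clK] clK by (auto simp: closed_subroot_system_def subroot_system_def)
  qed
  then have "maximal_in (L \<sigma>) H" using H HS by (auto simp: maximal_in_def)
  then show ?rhs using p pS ex \<Psi> by blast
next
  assume ?rhs
  then obtain p H where p: "linear p" "\<And>\<alpha>. \<alpha> \<in> R \<Longrightarrow> p \<alpha> \<in> L \<sigma>"
    and H: "maximal_in (L \<sigma>) H" and ex: "\<And>\<alpha>. \<alpha> \<in> R \<Longrightarrow> \<exists>y\<in>L \<alpha>. y - p \<alpha> \<in> H"
    and \<Psi>: "\<Psi> = coset_system R L p H"
    by blast
  have Hs: "additive_subgroup H" "H \<subset> L \<sigma>" using H by (auto simp: maximal_in_def)
  have cl: "closed_subroot_system R L \<Psi>" and gr: "gradient R L \<Psi> = R"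
    using coset_system_closed_full[OF p Hs ex] \<Psi> by auto
  have False if cl': "closed_subroot_system R L \<Psi>'" and lt: "\<Psi> \<subset> \<Psi>'" "\<Psi>' \<subset> real_roots R L" for \<Psi>'
  proof -
    have sub: "x \<in> \<Psi>'" if "x \<in> \<Psi>" for x using lt(1) that by auto
    have "gradient R L \<Psi>' = R" using gr lt(1) by (fastforce simp: gradient_def)
    then obtain p' H' where p': "linear p'" "\<And>\<alpha>. \<alpha> \<in> R \<Longrightarrow> p' \<alpha> \<in> L \<alpha>"
      and H': "additive_subgroup H'" "H' \<subseteq> L \<sigma>" and \<Psi>': "\<Psi>' = coset_system R L p' H'"
      using closed_full_imp_coset_system[OF cl'] by blast
    note S = family_subgroup[OF L]
    have p\<sigma>: "p \<sigma> - p' \<sigma> \<in> H'"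
    proof -
      have "(\<sigma>, p \<sigma>) \<in> \<Psi>" using p \<sigma> additive_subgroup_zero[OF Hs(1)] by (simp add: \<Psi>)
      from sub[OF this] show ?thesis by (simp add: \<Psi>')
    qed
    have "H \<subseteq> H'"
    proof
      fix h assume h: "h \<in> H"
      then have "h + p \<sigma> \<in> L \<sigma>" using additive_subgroup_add[OF S] Hs p(2)[OF \<sigma>] by auto
      then have "(\<sigma>, h + p \<sigma>) \<in> \<Psi>" using h \<sigma> by (simp add: \<Psi>)
      from sub[OF this] have "h + p \<sigma> - p' \<sigma> \<in> H'" by (simp add: \<Psi>')
      then have "(h + p \<sigma> - p' \<sigma>) - (p \<sigma> - p' \<sigma>) \<in> H'" by (rule additive_subgroup_diff[OF H'(1) _ p\<sigma>])
      then show "h \<in> H'" by simp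
    qed
    moreover have "H' \<noteq> L \<sigma>"
    proof
      assume eq: "H' = L \<sigma>"
      have "real_roots R L \<subseteq> \<Psi>'"
        using p'(2) family_subset[OF L, THEN subsetD] additive_subgroup_diff[OF S]
        by (auto simp: real_roots_def \<Psi>' eq subset_eq)
      then show False using lt by auto
    qed
    ultimately have HH: "H' = H" using H H' by (auto simp: maximal_in_def)
    have "\<Psi>' \<subseteq> \<Psi>"
    proof
      fix x assume x: "x \<in> \<Psi>'"
      obtain \<alpha> y where xy: "x = (\<alpha>, y)" by (cases x)
      then have y: "\<alpha> \<in> R" "y \<in> L \<alpha>" "y - p' \<alpha> \<in> H" using x by (auto simp: \<Psi>' HH)
      obtain z where z: "z \<in> L \<alpha>" "z - p \<alpha> \<in> H" using ex y by blast
      then have "(\<alpha>, z) \<in> \<Psi>" using y by (simp add: \<Psi>)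
      from sub[OF this] have "z - p' \<alpha> \<in> H" by (simp add: \<Psi>' HH)
      \<comment> \<open>The element z lies in both cosets over \<alpha>; passing through it turns
        the condition relative to p' into the one relative to p.\<close>
      then have "(y - p' \<alpha>) - (z - p' \<alpha>) + (z - p \<alpha>) \<in> H"

        by (rule additive_subgroup_add[OF Hs(1) additive_subgroup_diff[OF Hs(1) y(3)] z(2)])
      then show "x \<in> \<Psi>" using y by (simp add: \<Psi> xy)
    qed
    then show False using lt by auto
  qed
  then show ?lhs using cl gr by (auto simp: maximal_closed_subroot_system_def)
qed

end

end

section \<open>The quotient group\<close>

lemma add_group_simps [simp]:
  "carrier (add_group S) = S" "x \<otimes>\<^bsub>add_group S\<^esub> y = x + y" "\<one>\<^bsub>add_group S\<^esub> = 0"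
  by (simp_all add: add_group_def)

lemma comm_group_add_group:
  assumes "additive_subgroup S"
  shows "comm_group (add_group S)"
proof (rule comm_groupI)
  show "\<exists>y\<in>carrier (add_group S). y \<otimes>\<^bsub>add_group S\<^esub> x = \<one>\<^bsub>add_group S\<^esub>" if "x \<in> carrier (add_group S)" for x
    using that additive_subgroup_minus[OF assms] by (intro bexI[of _ "- x"]) auto
qed (use assms in \<open>auto simp: additive_subgroup_zero additive_subgroup_add add_ac\<close>)

lemma subgroup_add_group_iff:
  assumes "additive_subgroup S"
  shows "subgroup H (add_group S) \<longleftrightarrow> additive_subgroup H \<and> H \<subseteq> S"
proof -
  interpret comm_group "add_group S" using assms by (rule comm_group_add_group)
  have inv: "inv\<^bsub>add_group S\<^esub> x = - x" if "x \<in> S" for x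
    using that additive_subgroup_minus[OF assms] by (intro inv_equality) auto
  show ?thesis
  proof
    assume H: "subgroup H (add_group S)"
    have sub: "H \<subseteq> S" using subgroup.subset[OF H] by simp
    have "x - y \<in> H" if "x \<in> H" "y \<in> H" for x y
      using subgroup.m_closed[OF H that(1) subgroup.m_inv_closed[OF H that(2)]] inv sub that by auto
    then show "additive_subgroup H \<and> H \<subseteq> S"
      using sub subgroup.one_closed[OF H] by (auto simp: additive_subgroup_def)
  next
    assume "additive_subgroup H \<and> H \<subseteq> S"
    then show "subgroup H (add_group S)"
      by unfold_locales
         (auto simp: inv subset_iff additive_subgroup_zero additive_subgroup_minus additive_subgroup_add)
  qed
qed

lemma maximal_subgroup_add_group_iff:
  assumes "additive_subgroup S"
  shows "maximal_subgroup H (add_group S) \<longleftrightarrow> maximal_in S H"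
  unfolding maximal_subgroup_def maximal_in_def subgroup_add_group_iff[OF assms] by auto

lemma r_coset_add_group: "H #>\<^bsub>add_group S\<^esub> a = {y. y - a \<in> H}"
  by (auto simp: r_coset_def)

text \<open>A homomorphism from the root lattice to the quotient is lifted by choosing
  representatives at the independent simple roots and extending linearly. The lattice points where
  the lift is correct form a group, and integrality of Cartan integers carries correctness from
  simple roots to all roots.\<close>

lemma (in irreducible_root_system) Z_linear_iff:
  fixes S :: "'y::real_vector set"
  assumes S: "additive_subgroup S" and H: "additive_subgroup H" "H \<subseteq> S"
  shows "Z_linear R (add_group S Mod H) \<tau> \<longleftrightarrow>
    (\<exists>p. linear p \<and> (\<forall>\<alpha>\<in>R. p \<alpha> \<in> S) \<and> (\<forall>\<alpha>\<in>R. \<tau> \<alpha> = {y. y - p \<alpha> \<in> H}))" (is "?lhs \<longleftrightarrow> ?rhs")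
proof -
  let ?G = "add_group S"
  let ?Q = "group_closure R"
  interpret comm_group ?G using S by (rule comm_group_add_group)
  have "subgroup H ?G" using subgroup_add_group_iff[OF S] H by blast
  then interpret normal H ?G by (rule subgroup_imp_normal)
  interpret Mod: group "?G Mod H" by (rule factorgroup_is_group)
  have mult: "(H #>\<^bsub>?G\<^esub> x) \<otimes>\<^bsub>?G Mod H\<^esub> (H #>\<^bsub>?G\<^esub> y) = H #>\<^bsub>?G\<^esub> (x + y)"
    if "x \<in> S" "y \<in> S" for x y
    using rcos_sum[of x y] that by simp
  have rc: "H #>\<^bsub>?G\<^esub> x \<in> carrier (?G Mod H)" if "x \<in> S" for x
    using that by (auto simp: FactGroup_def RCOSETS_def)
  have pQ: "p x \<in> S" if "linear p" "\<And>\<alpha>. \<alpha> \<in> A \<Longrightarrow> p \<alpha> \<in> S" "x \<in> group_closure A" for p :: "'a \<Rightarrow> 'y" and x A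
    using that(3)
    by induction (use that S in \<open>auto simp: linear_0 linear_diff additive_subgroup_zero additive_subgroup_diff\<close>)
  show ?thesis
  proof
    assume ?rhs
    then obtain p where p: "linear p" "\<And>\<alpha>. \<alpha> \<in> R \<Longrightarrow> p \<alpha> \<in> S" "\<And>\<alpha>. \<alpha> \<in> R \<Longrightarrow> \<tau> \<alpha> = {y. y - p \<alpha> \<in> H}"
      by blast
    have "(\<lambda>x. H #>\<^bsub>?G\<^esub> p x) \<in> hom (add_group ?Q) (?G Mod H)"
    proof (rule homI)
      fix x y assume "x \<in> carrier (add_group ?Q)" "y \<in> carrier (add_group ?Q)"
      then have "p x \<in> S" "p y \<in> S" using pQ[of p R] p by auto
      then show "H #>\<^bsub>?G\<^esub> p (x \<otimes>\<^bsub>add_group ?Q\<^esub> y) = (H #>\<^bsub>?G\<^esub> p x) \<otimes>\<^bsub>?G Mod H\<^esub> (H #>\<^bsub>?G\<^esub> p y)"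
        unfolding mult[OF \<open>p x \<in> S\<close> \<open>p y \<in> S\<close>] by (simp add: linear_add[OF p(1)])
    qed (use pQ[of p R] p rc in auto)
    then show ?lhs
      unfolding Z_linear_def using p(3) by (auto simp: r_coset_add_group)
  next
    assume ?lhs
    then obtain h where h: "h \<in> hom (add_group ?Q) (?G Mod H)" "\<And>\<alpha>. \<alpha> \<in> R \<Longrightarrow> \<tau> \<alpha> = h \<alpha>"
      by (auto simp: Z_linear_def)
    obtain D where D: "D \<subseteq> R" "independent D"
      and gen: "\<And>Q. D \<subseteq> Q \<Longrightarrow> \<forall>a\<in>Q. \<forall>b\<in>Q. root_reflection a b \<in> Q \<Longrightarrow> R \<subseteq> Q"
      using generating_base by blast
    have RQ: "R \<subseteq> ?Q" by (auto intro: group_closure.base)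
    have "\<exists>s\<in>S. h x = H #>\<^bsub>?G\<^esub> s" if "x \<in> ?Q" for x
      using hom_in_carrier[OF h(1), of x] that by (auto simp: FactGroup_def RCOSETS_def)
    then obtain q where q: "\<And>x. x \<in> ?Q \<Longrightarrow> q x \<in> S" "\<And>x. x \<in> ?Q \<Longrightarrow> h x = H #>\<^bsub>?G\<^esub> q x" by metis
    obtain p where p: "linear p" "\<And>d. d \<in> D \<Longrightarrow> p d = q d"
      using linear_independent_extend[OF D(2), of q] by blast
    \<comment> \<open>Membership of \<open>p x\<close> in S is recorded because the product formula
      for cosets needs representatives in S.\<close>
    define T where "T = {x\<in>?Q. p x \<in> S \<and> h x = H #>\<^bsub>?G\<^esub> p x}"
    have DT: "D \<subseteq> T" using D RQ q p by (auto simp: T_def)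
    have h_diff: "x - y \<in> T" if xy: "x \<in> T" "y \<in> T" for x y
    proof -
      have Q: "x \<in> ?Q" "y \<in> ?Q" "x - y \<in> ?Q" and pS: "p x \<in> S" "p y \<in> S" "p x - p y \<in> S"
        using xy group_closure.diff S by (auto simp: T_def additive_subgroup_diff)
      have "h (x - y) \<otimes>\<^bsub>?G Mod H\<^esub> h y = h x"
        using hom_mult[OF h(1), of "x - y" y] Q by simp
      moreover have "h x = (H #>\<^bsub>?G\<^esub> (p x - p y)) \<otimes>\<^bsub>?G Mod H\<^esub> h y"
        using mult[OF pS(3,2)] xy by (simp add: T_def)
      moreover have "h (x - y) \<in> carrier (?G Mod H)" "h y \<in> carrier (?G Mod H)"
        using hom_in_carrier[OF h(1)] Q by auto
      ultimately have "h (x - y) = H #>\<^bsub>?G\<^esub> (p x - p y)"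
        using rc[OF pS(3)] Mod.right_cancel by metis
      then show ?thesis using Q pS by (simp add: T_def linear_diff[OF p(1)])
    qed
    \<comment> \<open>If D were empty, the empty set would be reflection-closed and contain R. An
      element of T is wanted so that its difference with itself gives 0.\<close>
    have "D \<noteq> {}" using gen[of "{}"] R_nonempty by auto
    then obtain d where "d \<in> T" using DT by auto
    then have "0 \<in> T" using h_diff[of d d] by simp
    then have T: "additive_subgroup T" using h_diff by (auto simp: additive_subgroup_def)
    \<comment> \<open>Inside R the Cartan integers are integers, so a reflection subtracts an
      integer multiple and stays in the group T.\<close>
    have "R \<subseteq> R \<inter> T"
    proof (rule gen)
      show "\<forall>a\<in>R \<inter> T. \<forall>b\<in>R \<inter> T. root_reflection a b \<in> R \<inter> T"
        using reflection_root additive_subgroup_diff[OF T] additive_subgroup_scale[OF T] cartan_int_Ints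
        by (auto simp: root_reflection_def)
    qed (use D DT in auto)
    then have "R \<subseteq> T" by auto
    then show ?rhs
      using p h by (intro exI[of _ p]) (auto simp: T_def r_coset_add_group)
  qed
qed

section \<open>Cosets of maximal subgroups\<close>

lemma extension_datum_reflection_family: "extension_datum R Y L \<Longrightarrow> reflection_family R L"
  by (simp add: extension_datum_def reflection_family_def)

context root_system_with_minimal_A2 begin

lemma short_roots_norm:
  assumes "\<alpha> \<in> short_roots R"
  shows "norm \<alpha> = norm \<sigma>"
proof -
  obtain \<beta> where "\<alpha> \<in> R" "\<beta> \<in> R" "norm \<alpha> < norm \<beta>"
    using assms by (auto simp: short_roots_def long_roots_def not_le)
  then have "norm \<alpha> \<le> norm \<sigma>" using nonmaximal_imp_minimal \<sigma> by blast
  then show ?thesis using \<sigma>_minimal \<open>\<alpha> \<in> R\<close> by (simp add: order_antisym)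
qed

context
  fixes L :: "'a \<Rightarrow> 'y::real_vector set"
  assumes L: "reflection_family R L"
begin

lemma Lambda_long_eq:
  assumes "\<alpha> \<in> long_roots R"
  shows "Lambda_long R L = L \<alpha>"
  unfolding Lambda_long_def common_value_def
proof (rule the_equality)
  show "\<forall>\<beta>\<in>long_roots R. L \<beta> = L \<alpha>"
    using assms family_norm[OF L] by (auto simp: long_roots_def intro!: order_antisym)
qed (use assms in auto)

text \<open>With a single root length \<sigma> is itself long, which matches the convention for the
  simply-laced case; otherwise the short roots are those as long as \<sigma>.\<close>

lemma Lambda_short_eq: "Lambda_short R L = L \<sigma>"
proof (cases "short_roots R = {}")
  case True
  then have "\<sigma> \<in> long_roots R" using \<sigma> by (auto simp: short_roots_def)
  then show ?thesis using True Lambda_long_eq by (simp add: Lambda_short_def)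
next
  case False
  have *: "L \<alpha> = L \<sigma>" if "\<alpha> \<in> short_roots R" for \<alpha>
    using family_norm[OF L _ \<sigma>, of \<alpha>] that short_roots_norm by (auto simp: short_roots_def)
  have "common_value (short_roots R) L = L \<sigma>"
    unfolding common_value_def by (rule the_equality) (use False * in auto)
  then show ?thesis using False by (simp add: Lambda_short_def)
qed

lemma maximal_closed_iff:
  "maximal_closed_subroot_system R L \<Psi> \<and> gradient R L \<Psi> = R \<longleftrightarrow>
    (\<exists>H \<tau>.
       maximal_subgroup H (add_group (Lambda_short R L)) \<and>
       Z_linear R (add_group (Lambda_short R L) Mod H) \<tau> \<and>
       (\<forall>\<beta>\<in>long_roots R. \<tau> \<beta> \<inter> Lambda_long R L \<noteq> {}) \<and>
       \<Psi> = (SIGMA \<alpha>:short_roots R. \<tau> \<alpha>) \<union>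
           (SIGMA \<alpha>:long_roots R. \<tau> \<alpha> \<inter> Lambda_long R L))"
    (is "?lhs \<longleftrightarrow> (\<exists>H \<tau>. ?max H \<and> ?lin H \<tau> \<and> ?meets \<tau> \<and> \<Psi> = ?sys \<tau>)")
proof -
  note S = family_subgroup[OF L]
  have max: "?max H \<longleftrightarrow> maximal_in (L \<sigma>) H" for H
    by (simp add: Lambda_short_eq maximal_subgroup_add_group_iff[OF S])
  have lin: "?lin H \<tau> \<longleftrightarrow> (\<exists>p. linear p \<and> (\<forall>\<alpha>\<in>R. p \<alpha> \<in> L \<sigma>) \<and> (\<forall>\<alpha>\<in>R. \<tau> \<alpha> = {y. y - p \<alpha> \<in> H}))"
    if "maximal_in (L \<sigma>) H" for H \<tau>
    unfolding Lambda_short_eq by (rule Z_linear_iff[OF S]) (use that in \<open>auto simp: maximal_in_def\<close>)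
  have R: "R = short_roots R \<union> long_roots R" "long_roots R \<subseteq> R" "short_roots R \<subseteq> R"
    by (auto simp: short_roots_def long_roots_def)
  have short: "L \<alpha> = L \<sigma>" if "\<alpha> \<in> short_roots R" for \<alpha>
    using family_norm[OF L _ \<sigma>, of \<alpha>] that short_roots_norm R by auto
  have sys: "(?meets \<tau> \<longleftrightarrow> (\<forall>\<alpha>\<in>R. \<exists>y\<in>L \<alpha>. y - p \<alpha> \<in> H)) \<and> ?sys \<tau> = coset_system R L p H"
    if H: "maximal_in (L \<sigma>) H" and p: "\<And>\<alpha>. \<alpha> \<in> R \<Longrightarrow> p \<alpha> \<in> L \<sigma>"
      and \<tau>: "\<And>\<alpha>. \<alpha> \<in> R \<Longrightarrow> \<tau> \<alpha> = {y. y - p \<alpha> \<in> H}" for H p \<tau>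
  proof
    have H': "0 \<in> H" "H \<subseteq> L \<sigma>" using H additive_subgroup_zero by (auto simp: maximal_in_def)
    \<comment> \<open>Over short roots the fibre is all of \<open>L \<sigma>\<close>, so the coset
      meets it in \<open>p \<alpha>\<close>; only long roots carry a condition.\<close>
    have ex: "\<exists>y\<in>L \<alpha>. y - p \<alpha> \<in> H" if "\<alpha> \<in> short_roots R" for \<alpha>
      using that p short R H' by (intro bexI[of _ "p \<alpha>"]) auto
    have "\<tau> \<alpha> \<inter> Lambda_long R L = {y\<in>L \<alpha>. y - p \<alpha> \<in> H}" if "\<alpha> \<in> long_roots R" for \<alpha>
      using Lambda_long_eq[OF that] \<tau>[of \<alpha>] that R(2) by auto
    then have "?meets \<tau> \<longleftrightarrow> (\<forall>\<alpha>\<in>long_roots R. \<exists>y\<in>L \<alpha>. y - p \<alpha> \<in> H)"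
      by (intro ball_cong) auto
    then show "?meets \<tau> \<longleftrightarrow> (\<forall>\<alpha>\<in>R. \<exists>y\<in>L \<alpha>. y - p \<alpha> \<in> H)"
      using ex R by (metis Un_iff)
    have "\<tau> \<alpha> = \<tau> \<alpha> \<inter> L \<alpha>" if \<alpha>: "\<alpha> \<in> short_roots R" for \<alpha>
    proof -
      have "y \<in> L \<alpha>" if "y - p \<alpha> \<in> H" for y
        using additive_subgroup_add[OF S, of "y - p \<alpha>" "p \<alpha>"] that H' p \<alpha> R short by auto
      then show ?thesis using \<tau> \<alpha> R by auto
    qed
    then have "(SIGMA \<alpha>:short_roots R. \<tau> \<alpha>) = (SIGMA \<alpha>:short_roots R. \<tau> \<alpha> \<inter> L \<alpha>)"
      by (intro Sigma_cong) auto
    moreover have "(SIGMA \<alpha>:long_roots R. \<tau> \<alpha> \<inter> Lambda_long R L) = (SIGMA \<alpha>:long_roots R. \<tau> \<alpha> \<inter> L \<alpha>)"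
      by (intro Sigma_cong) (auto simp: Lambda_long_eq)
    moreover have "(SIGMA \<alpha>:short_roots R. \<tau> \<alpha> \<inter> L \<alpha>) \<union> (SIGMA \<alpha>:long_roots R. \<tau> \<alpha> \<inter> L \<alpha>) =
        (SIGMA \<alpha>:R. \<tau> \<alpha> \<inter> L \<alpha>)"
      using R(1) by auto
    moreover have "(SIGMA \<alpha>:R. \<tau> \<alpha> \<inter> L \<alpha>) = coset_system R L p H"
      using \<tau> by (auto simp: coset_system_def)
    ultimately show "?sys \<tau> = coset_system R L p H" by simp
  qed
  show ?thesis
    unfolding maximal_closed_iff_coset_system[OF L]
  proof
    assume "\<exists>p H. linear p \<and> (\<forall>\<alpha>\<in>R. p \<alpha> \<in> L \<sigma>) \<and> maximal_in (L \<sigma>) H \<and>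
      (\<forall>\<alpha>\<in>R. \<exists>y\<in>L \<alpha>. y - p \<alpha> \<in> H) \<and> \<Psi> = coset_system R L p H"
    then obtain p H where p: "linear p" "\<forall>\<alpha>\<in>R. p \<alpha> \<in> L \<sigma>" and H: "maximal_in (L \<sigma>) H"
      and *: "\<forall>\<alpha>\<in>R. \<exists>y\<in>L \<alpha>. y - p \<alpha> \<in> H" "\<Psi> = coset_system R L p H"
      by blast
    let ?\<tau> = "\<lambda>\<alpha>. {y. y - p \<alpha> \<in> H}"
    have "?lin H ?\<tau>" unfolding lin[OF H] using p by blast
    moreover have "?meets ?\<tau>" "\<Psi> = ?sys ?\<tau>" using sys[OF H, of p ?\<tau>] p * by simp_all
    ultimately show "\<exists>H \<tau>. ?max H \<and> ?lin H \<tau> \<and> ?meets \<tau> \<and> \<Psi> = ?sys \<tau>"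
      using H max by blast
  next
    assume "\<exists>H \<tau>. ?max H \<and> ?lin H \<tau> \<and> ?meets \<tau> \<and> \<Psi> = ?sys \<tau>"
    then obtain H \<tau> where H: "maximal_in (L \<sigma>) H" and \<tau>: "?lin H \<tau>" "?meets \<tau>" "\<Psi> = ?sys \<tau>"
      using max by blast
    obtain p where "linear p" "\<forall>\<alpha>\<in>R. p \<alpha> \<in> L \<sigma>" "\<forall>\<alpha>\<in>R. \<tau> \<alpha> = {y. y - p \<alpha> \<in> H}"
      using \<tau>(1) lin[OF H] by blast
    moreover from this have "\<forall>\<alpha>\<in>R. \<exists>y\<in>L \<alpha>. y - p \<alpha> \<in> H" "\<Psi> = coset_system R L p H"
      using sys[OF H, of p \<tau>] \<tau> by simp_all
    ultimately show "\<exists>p H. linear p \<and> (\<forall>\<alpha>\<in>R. p \<alpha> \<in> L \<sigma>) \<and> maximal_in (L \<sigma>) H \<and>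
      (\<forall>\<alpha>\<in>R. \<exists>y\<in>L \<alpha>. y - p \<alpha> \<in> H) \<and> \<Psi> = coset_system R L p H"
      using H by blast
  qed
qed

end

end

section \<open>The types in the theorem\<close>

context irreducible_root_system begin

lemma norm_eq_of_cartan_int:
  assumes "\<alpha> \<in> R" "\<beta> \<in> R" "cartan_int \<alpha> \<beta> = - real k" "cartan_int \<beta> \<alpha> = - 1" "k > 0"
  shows "(norm \<alpha>)\<^sup>2 = k * (norm \<beta>)\<^sup>2"
  using assms inner_pos[of \<alpha>] inner_pos[of \<beta>]
  by (simp add: cartan_int_eq power2_norm_eq_inner inner_commute field_simps)

text \<open>Simple roots meet with Cartan integer -1 while the locale asks for 1, hence the sign
  change.\<close>

lemma minimal_A2_I:
  assumes "\<alpha> \<in> R" "\<beta> \<in> R" "norm \<alpha> = norm \<beta>" "cartan_int \<alpha> \<beta> = - 1" "\<And>\<gamma>. \<gamma> \<in> R \<Longrightarrow> norm \<beta> \<le> norm \<gamma>"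
  shows "\<exists>\<sigma> \<sigma>'. root_system_with_minimal_A2 R \<sigma> \<sigma>'"
proof -
  have "root_system_with_minimal_A2 R \<beta> (- \<alpha>)"
    by unfold_locales (use assms minus_root in auto)
  then show ?thesis by blast
qed

lemma has_cartan_matrix_simple_roots:
  assumes "has_cartan_matrix R n A"
  shows "\<exists>b. (\<forall>i<n. b i \<in> R) \<and> (\<forall>i<n. \<forall>j<n. cartan_int (b i) (b j) = of_int (A i j))"
  using assms unfolding has_cartan_matrix_def base_of_def by blast

text \<open>If every root other than \<alpha> and its negative were orthogonal to \<alpha>,
  irreducibility would leave only these two, which span a line. A non-orthogonal root of equal
  length gives Cartan integer 1 or -1, and the sign of \<alpha> can be adjusted.\<close>

lemma minimal_A2_simply_laced:
  assumes "simply_laced R" "dim R \<ge> 2"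
  shows "\<exists>\<sigma> \<sigma>'. root_system_with_minimal_A2 R \<sigma> \<sigma>'"
proof -
  have n: "norm \<alpha> = norm \<beta>" if "\<alpha> \<in> R" "\<beta> \<in> R" for \<alpha> \<beta>
    using assms that unfolding simply_laced_def by blast
  obtain \<alpha> where \<alpha>: "\<alpha> \<in> R" using R_nonempty by blast
  have "\<exists>\<beta>\<in>R. \<beta> \<noteq> \<alpha> \<and> \<beta> \<noteq> - \<alpha> \<and> \<alpha> \<bullet> \<beta> \<noteq> 0"
  proof (rule ccontr)
    assume *: "\<not> ?thesis"
    have "R \<subseteq> {\<alpha>, - \<alpha>}"
    proof (rule ccontr)
      assume ne: "\<not> R \<subseteq> {\<alpha>, - \<alpha>}"
      have "\<exists>A B. A \<noteq> {} \<and> B \<noteq> {} \<and> A \<union> B = R \<and> A \<inter> B = {} \<and> (\<forall>a\<in>A. \<forall>b\<in>B. a \<bullet> b = 0)"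
      proof (intro exI conjI)
        show "{\<alpha>, - \<alpha>} \<noteq> {}" "R - {\<alpha>, - \<alpha>} \<noteq> {}" using ne by auto
        show "{\<alpha>, - \<alpha>} \<union> (R - {\<alpha>, - \<alpha>}) = R" "{\<alpha>, - \<alpha>} \<inter> (R - {\<alpha>, - \<alpha>}) = {}"
          using \<alpha> minus_root[OF \<alpha>] by auto
        show "\<forall>a\<in>{\<alpha>, - \<alpha>}. \<forall>b\<in>R - {\<alpha>, - \<alpha>}. a \<bullet> b = 0" using * by auto
      qed
      then show False using irreducible unfolding irreducible_rs_def by metis
    qed
    then have "R \<subseteq> span {\<alpha>}" by (auto simp: span_base span_neg)
    then have "dim R \<le> card {\<alpha>}" by (rule dim_le_card) simp
    then show False using assms by simp
  qed
  then obtain \<beta> where \<beta>: "\<beta> \<in> R" "\<beta> \<noteq> \<alpha>" "\<beta> \<noteq> - \<alpha>" "\<alpha> \<bullet> \<beta> \<noteq> 0" by blast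
  then have c: "cartan_int \<alpha> \<beta> \<in> {1, -1}" using cartan_int_cases(1)[OF \<alpha> \<beta>] n[OF \<alpha> \<beta>(1)] by simp
  then consider "cartan_int \<alpha> \<beta> = - 1" | "cartan_int (- \<alpha>) \<beta> = - 1" by auto
  then show ?thesis
  proof cases
    case 1
    show ?thesis
      by (rule minimal_A2_I[OF \<alpha> \<beta>(1) n[OF \<alpha> \<beta>(1)] 1 eq_refl[OF n[OF \<beta>(1)]]])
  next
    case 2
    show ?thesis
      by (rule minimal_A2_I[OF minus_root[OF \<alpha>] \<beta>(1) n[OF minus_root[OF \<alpha>] \<beta>(1)] 2 eq_refl[OF n[OF \<beta>(1)]]])
  qed
qed

text \<open>All simple roots but the last have equal length and the last is longer. For
  \<open>n \<ge> 3\<close> the roots \<open>b 0\<close> and \<open>b 1\<close> are two adjacent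
  short ones.\<close>

lemma minimal_A2_C:
  assumes "type_C n R" "n \<ge> 3"
  shows "\<exists>\<sigma> \<sigma>'. root_system_with_minimal_A2 R \<sigma> \<sigma>'"
proof -
  obtain b where b: "\<forall>i<n. b i \<in> R" "\<forall>i<n. \<forall>j<n. cartan_int (b i) (b j) = of_int (cartan_C n i j)"
    using has_cartan_matrix_simple_roots[OF assms(1)[unfolded type_C_def]] by blast
  note bR = b(1)[rule_format] and c = b(2)[rule_format]
  have step: "(norm (b i))\<^sup>2 = (norm (b (Suc i)))\<^sup>2" if "Suc (Suc i) < n" for i
    using norm_eq_of_cartan_int[of "b i" "b (Suc i)" 1] that bR[of i] bR[of "Suc i"]
      c[of i "Suc i"] c[of "Suc i" i] by (simp add: cartan_C_def)
  have eq: "(norm (b i))\<^sup>2 = (norm (b 0))\<^sup>2" if "Suc i < n" for i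
    using that by (induction i) (auto simp: step)
  obtain m where m: "n = Suc (Suc m)" using assms(2) by (metis Suc_le_D numeral_3_eq_3 le_Suc_ex add_Suc)
  have "(norm (b (Suc m)))\<^sup>2 = 2 * (norm (b m))\<^sup>2"
    using norm_eq_of_cartan_int[of "b (Suc m)" "b m" 2] bR[of "Suc m"] bR[of m]
      c[of "Suc m" m] c[of m "Suc m"] by (simp add: cartan_C_def m)
  moreover have "(norm (b m))\<^sup>2 = (norm (b 0))\<^sup>2" using eq[of m] m by simp
  moreover have "(norm (b 0))\<^sup>2 > 0" using bR[of 0] root_nonzero assms by auto
  ultimately have "(norm (b 0))\<^sup>2 < (norm (b (Suc m)))\<^sup>2" by simp
  then have lt: "norm (b 0) < norm (b (Suc m))" by (simp add: power_less_imp_less_base)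
  have n01: "norm (b 1) = norm (b 0)" using eq[of 1] assms by simp
  have "cartan_int (b 1) (b 0) = - 1" using c[of 1 0] assms by (simp add: cartan_C_def)
  then show ?thesis
    using n01 bR[of 0] bR[of 1] bR[of "Suc m"] lt nonmaximal_imp_minimal[of "b 0" "b (Suc m)"] assms m
    by (intro minimal_A2_I[of "b 1" "b 0"]) auto
qed

text \<open>The double bond makes \<open>b 1\<close> longer than \<open>b 2\<close>, and
  \<open>b 2\<close>, \<open>b 3\<close> are adjacent of equal length.\<close>

lemma minimal_A2_F4:
  assumes "type_F4 R"
  shows "\<exists>\<sigma> \<sigma>'. root_system_with_minimal_A2 R \<sigma> \<sigma>'"
proof -
  obtain b where b: "\<forall>i<4. b i \<in> R" "\<forall>i<4. \<forall>j<4. cartan_int (b i) (b j) = of_int (cartan_F4 i j)"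
    using has_cartan_matrix_simple_roots[OF assms(1)[unfolded type_F4_def]] by blast
  note bR = b(1)[rule_format] and c = b(2)[rule_format]
  have "(norm (b 1))\<^sup>2 = 2 * (norm (b 2))\<^sup>2"
    using norm_eq_of_cartan_int[of "b 1" "b 2" 2] bR[of 1] bR[of 2]
      c[of 1 2] c[of 2 1] by (simp add: cartan_F4_def)
  moreover have "(norm (b 2))\<^sup>2 > 0" using bR[of 2] root_nonzero by auto
  ultimately have "(norm (b 2))\<^sup>2 < (norm (b 1))\<^sup>2" by simp
  then have lt: "norm (b 2) < norm (b 1)" by (simp add: power_less_imp_less_base)
  have "(norm (b 3))\<^sup>2 = (norm (b 2))\<^sup>2"
    using norm_eq_of_cartan_int[of "b 3" "b 2" 1] bR[of 3] bR[of 2]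
      c[of 3 2] c[of 2 3] by (simp add: cartan_F4_def)
  then have n: "norm (b 3) = norm (b 2)" by simp
  have "cartan_int (b 3) (b 2) = - 1" using c[of 3 2] by (simp add: cartan_F4_def)
  then show ?thesis
    using n bR[of 1] bR[of 2] bR[of 3] lt nonmaximal_imp_minimal[of "b 2" "b 1"]
    by (intro minimal_A2_I[of "b 3" "b 2"]) auto
qed

text \<open>Only one simple root is short, so the second short root is the reflection
  \<open>b 0 + b 1\<close> of \<open>b 0\<close> in \<open>b 1\<close>; its Cartan integer against
  \<open>b 0\<close> is 2 - 3 = -1.\<close>

lemma minimal_A2_G2:
  assumes "type_G2 R"
  shows "\<exists>\<sigma> \<sigma>'. root_system_with_minimal_A2 R \<sigma> \<sigma>'"
proof -
  obtain b where b: "\<forall>i<2. b i \<in> R" "\<forall>i<2. \<forall>j<2. cartan_int (b i) (b j) = of_int (cartan_G2 i j)"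
    using has_cartan_matrix_simple_roots[OF assms(1)[unfolded type_G2_def]] by blast
  note bR = b(1)[rule_format] and c = b(2)[rule_format]
  have c01: "cartan_int (b 0) (b 1) = - 1" and c10: "cartan_int (b 1) (b 0) = - 3"
    using c[of 0 1] c[of 1 0] by (simp_all add: cartan_G2_def)
  have "(norm (b 1))\<^sup>2 = 3 * (norm (b 0))\<^sup>2"
    using norm_eq_of_cartan_int[of "b 1" "b 0" 3] bR[of 0] bR[of 1] c01 c10 by simp
  moreover have "(norm (b 0))\<^sup>2 > 0" using bR[of 0] root_nonzero by auto
  ultimately have "(norm (b 0))\<^sup>2 < (norm (b 1))\<^sup>2" by simp
  then have lt: "norm (b 0) < norm (b 1)" by (simp add: power_less_imp_less_base)
  have r: "root_reflection (b 1) (b 0) = b 0 + b 1" using c01 by (simp add: root_reflection_def)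
  then have "b 0 + b 1 \<in> R" "norm (b 0 + b 1) = norm (b 0)"
    using reflection_root[of "b 1" "b 0"] bR[of 0] bR[of 1] norm_root_reflection[of "b 1" "b 0"] by auto
  moreover have "cartan_int (b 0 + b 1) (b 0) = - 1"
    using c10 cartan_int_self[of "b 0"] root_nonzero[OF bR[of 0]]
    by (simp add: cartan_int_eq inner_add_left add_divide_distrib)
  ultimately show ?thesis
    using bR[of 0] bR[of 1] lt nonmaximal_imp_minimal[of "b 0" "b 1"]
    by (intro minimal_A2_I[of "b 0 + b 1" "b 0"]) auto
qed

end

theorem theorem6:
  fixes R :: "'a::euclidean_space set"
    and Y :: "'y::real_vector set"
    and L :: "'a \<Rightarrow> 'y set"
    and \<Psi> :: "('a \<times> 'y) set"
  assumes "finite_root_system R" and "reduced_rs R" and "irreducible_rs R"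
    and "extension_datum R Y L"
    and "(simply_laced R \<and> dim R \<ge> 2) \<or> (\<exists>n\<ge>3. type_C n R) \<or> type_F4 R \<or> type_G2 R"
    and "\<Psi> \<subseteq> affine_roots R L"
  shows "maximal_closed_subroot_system R L \<Psi> \<and> gradient R L \<Psi> = R \<longleftrightarrow>
    (\<exists>H \<tau>.
       maximal_subgroup H (add_group (Lambda_short R L)) \<and>
       Z_linear R (add_group (Lambda_short R L) Mod H) \<tau> \<and>
       (\<forall>\<beta>\<in>long_roots R. \<tau> \<beta> \<inter> Lambda_long R L \<noteq> {}) \<and>
       \<Psi> = (SIGMA \<alpha>:short_roots R. \<tau> \<alpha>) \<union>
           (SIGMA \<alpha>:long_roots R. \<tau> \<alpha> \<inter> Lambda_long R L))"
proof -
  interpret irreducible_root_system R using assms(1-3) by unfold_locales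
  obtain \<sigma> \<sigma>' where "root_system_with_minimal_A2 R \<sigma> \<sigma>'"
    using assms(5) minimal_A2_simply_laced minimal_A2_C minimal_A2_F4 minimal_A2_G2 by blast
  then interpret root_system_with_minimal_A2 R \<sigma> \<sigma>' .
  show ?thesis
    by (rule maximal_closed_iff[OF extension_datum_reflection_family[OF assms(4)]])
qed

end
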